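(* Let $\mathfrak g$ be a Lie algebra of finite or affine type, let $\lambda\in\mathfrak h^*$, and let $V$ be a highest weight $\mathfrak g$-module with highest weight $\lambda$. Then $$\mathrm{wt}\,V=\mathrm{wt}_{J_\lambda}V-\mathbb Z_{\ge0}\Delta_{J_\lambda^c,1}=\mathrm{wt}_{J_\lambda}V-\mathbb Z_{\ge0}(\Delta^+\setminus\Delta^+_{J_\lambda}).$$
   Context: $\mathfrak g=\mathfrak g(A)$ is either a complex finite-dimensional simple Lie algebra ("finite type") or a complex affine Kac--Moody Lie algebra ("affine type"), with Cartan matrix $A$, fixed Cartan subalgebra $\mathfrak h$, root system $\Delta\subset\mathfrak h^*$ (all roots, real and imaginary), positive roots $\Delta^+$, simple roots $\Pi=\{\alpha_i\mid i\in\mathcal I\}$, simple co-roots $\{\alpha_i^\vee\mid i\in\mathcal I\}\subset\mathfrak h$, and Chevalley generators $e_i,f_i,\alpha_i^\vee$ $(i\in\mathcal I)$; $\mathcal I$ is the set of nodes of the Dynkin diagram. For $x=\sum_{i\in\mathcal I}c_i\alpha_i$ and $I\subseteq\mathcal I$, put $\mathrm{ht}_I(x):=\sum_{i\in I}c_i$, $I^c:=\mathcal I\setminus I$, and $\Delta_{I,1}:=\{\beta\in\Delta\mid\mathrm{ht}_I(\beta)=1\}\subseteq\Delta^+$ (so $\Delta_{\emptyset,1}=\emptyset$). For a subset $S$ of a real vector space, $\mathbb Z_{\ge0}S$ is the set of finite $\mathbb Z_{\ge0}$-linear combinations of elements of $S$ (so $\mathbb Z_{\ge0}\emptyset=\{0\}$).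 For $J\subseteq\mathcal I$: $\Pi_J=\{\alpha_j\mid j\in J\}$, $\Delta_J=\Delta\cap\mathbb Z\Pi_J$, $\Delta_J^+=\Delta_J\cap\Delta^+$. A $\mathfrak g$-module $V$ is a highest weight module of highest weight $\lambda\in\mathfrak h^*$ if it is generated over $\mathfrak g$ by a nonzero vector $v$ (a highest weight vector) with $hv=\langle\lambda,h\rangle v$ for all $h\in\mathfrak h$ and $e_iv=0$ for all $i\in\mathcal I$. $\mathrm{wt}\,V:=\{\mu\in\mathfrak h^*\mid V_\mu\ne0\}$, where $V_\mu=\{v\in V\mid hv=\langle\mu,h\rangle v\ \forall h\in\mathfrak h\}$. Further, $J_\lambda:=\{j\in\mathcal I\mid\langle\lambda,\alpha_j^\vee\rangle\in\mathbb Z_{\ge0}\}$ and $\mathrm{wt}_{J_\lambda}V:=(\lambda-\mathbb Z_{\ge0}\Pi_{J_\lambda})\cap\mathrm{wt}\,V$. For sets $A,B\subset\mathfrak h^*$, $A-B:=\{a-b\mid a\in A,b\in B\}$. *)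

theory Defs
  imports "HOL-Analysis.Analysis"
begin

section \<open>Complex Lie algebras and their modules\<close>

locale complex_lie_algebra = vector_space scl
  for scl :: "complex \<Rightarrow> 'g::ab_group_add \<Rightarrow> 'g" +
  fixes br :: "'g \<Rightarrow> 'g \<Rightarrow> 'g"
  assumes br_add_left: "br (x + y) z = br x z + br y z"
    and br_add_right: "br x (y + z) = br x y + br x z"
    and br_scale_left: "br (scl c x) y = scl c (br x y)"
    and br_scale_right: "br x (scl c y) = scl c (br x y)"
    and br_self: "br x x = 0"
    and jacobi: "br x (br y z) + br y (br z x) + br z (br x y) = 0"
begin

definition lie_subalgebra :: "'g set \<Rightarrow> bool" where
  "lie_subalgebra S \<longleftrightarrow> subspace S \<and> (\<forall>x\<in>S. \<forall>y\<in>S. br x y \<in> S)"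

definition lie_ideal :: "'g set \<Rightarrow> bool" where
  "lie_ideal N \<longleftrightarrow> subspace N \<and> (\<forall>x. \<forall>y\<in>N. br x y \<in> N)"

end

definition fin_dim :: "(complex \<Rightarrow> 'g::ab_group_add \<Rightarrow> 'g) \<Rightarrow> bool" where
  "fin_dim scl \<longleftrightarrow> (\<exists>B. finite B \<and> module.span scl B = UNIV)"

definition simple_lie_algebra ::
  "(complex \<Rightarrow> 'g::ab_group_add \<Rightarrow> 'g) \<Rightarrow> ('g \<Rightarrow> 'g \<Rightarrow> 'g) \<Rightarrow> bool" where
  "simple_lie_algebra scl br \<longleftrightarrow> complex_lie_algebra scl br \<and> (\<exists>x y. br x y \<noteq> 0) \<and>
     (\<forall>N. complex_lie_algebra.lie_ideal scl br N \<longrightarrow> N = {0} \<or> N = UNIV)"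

locale lie_module = complex_lie_algebra scl br + M: vector_space smul
  for scl :: "complex \<Rightarrow> 'g::ab_group_add \<Rightarrow> 'g" and br
    and smul :: "complex \<Rightarrow> 'v::ab_group_add \<Rightarrow> 'v" +
  fixes act :: "'g \<Rightarrow> 'v \<Rightarrow> 'v"
  assumes act_add_left: "act (x + y) v = act x v + act y v"
    and act_add_right: "act x (v + w) = act x v + act x w"
    and act_scale_left: "act (scl c x) v = smul c (act x v)"
    and act_scale_right: "act x (smul c v) = smul c (act x v)"
    and act_br: "act (br x y) v = act x (act y v) - act y (act x v)"
begin

definition submodule :: "'v set \<Rightarrow> bool" where
  "submodule U \<longleftrightarrow> M.subspace U \<and> (\<forall>x. \<forall>u\<in>U. act x u \<in> U)"

end


section \<open>Cartan matrices\<close>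

definition generalized_cartan_matrix :: "int^'i^'i \<Rightarrow> bool" where
  "generalized_cartan_matrix A \<longleftrightarrow> (\<forall>i. A $ i $ i = 2) \<and>
     (\<forall>i j. i \<noteq> j \<longrightarrow> A $ i $ j \<le> 0) \<and> (\<forall>i j. A $ i $ j = 0 \<longrightarrow> A $ j $ i = 0)"

definition indecomposable_matrix :: "int^'i^'i \<Rightarrow> bool" where
  "indecomposable_matrix A \<longleftrightarrow>
     \<not> (\<exists>S. S \<noteq> {} \<and> S \<noteq> UNIV \<and> (\<forall>i\<in>S. \<forall>j\<in>-S. A $ i $ j = 0 \<and> A $ j $ i = 0))"

abbreviation real_matrix :: "int^'i^'i \<Rightarrow> real^'i^'i" where
  "real_matrix A \<equiv> map_matrix real_of_int A"

text \<open>Type (Aff) in Kac's trichotomy Fin/Aff/Ind of indecomposable generalized Cartan matrices.\<close>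

definition affine_cartan_matrix :: "int^'i^'i \<Rightarrow> bool" where
  "affine_cartan_matrix A \<longleftrightarrow> generalized_cartan_matrix A \<and> indecomposable_matrix A \<and>
     rank (real_matrix A) + 1 = CARD('i) \<and>
     (\<exists>u. (\<forall>i. u $ i > 0) \<and> real_matrix A *v u = 0) \<and>
     (\<forall>v. (\<forall>i. (real_matrix A *v v) $ i \<ge> 0) \<longrightarrow> real_matrix A *v v = 0)"


section \<open>Kac--Moody algebras\<close>

text \<open>
  The dual of a subspace \<open>H\<close> of \<open>'g\<close>. Functionals on \<open>H\<close> are represented by functions on \<open>'g\<close>
  that vanish outside \<open>H\<close>, so that equality of functionals is equality of functions; sums and
  differences are pointwise.
\<close>

definition dual_space ::
  "(complex \<Rightarrow> 'g::ab_group_add \<Rightarrow> 'g) \<Rightarrow> 'g set \<Rightarrow> ('g \<Rightarrow> complex) set" where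
  "dual_space scl H = {\<mu>. (\<forall>x\<in>H. \<forall>y\<in>H. \<mu> (x + y) = \<mu> x + \<mu> y) \<and>
     (\<forall>c. \<forall>x\<in>H. \<mu> (scl c x) = c * \<mu> x) \<and> (\<forall>x. x \<notin> H \<longrightarrow> \<mu> x = 0)}"

text \<open>
  The Lie algebra \<open>\<gg>(A)\<close> with its Cartan subalgebra \<open>H\<close>, simple co-roots, simple roots and
  Chevalley generators. Kac's \<open>\<gg>(A)\<close> is the quotient of the Lie algebra generated by \<open>H\<close>, the
  \<open>e\<^sub>i\<close> and the \<open>f\<^sub>i\<close> subject to the relations below by its largest ideal meeting \<open>H\<close> trivially;
  this is axiomatized by \<open>generated\<close> together with \<open>no_ideals\<close>. The axioms on \<open>H\<close>, \<open>coroot\<close> and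
  \<open>\<alpha>\<close> before the bracket relations say that they form a (minimal) realization of \<open>A\<close>. As
  \<open>dim\<close> is \<open>0\<close> for infinite-dimensional spaces and \<open>2 * CARD('i) - rank\<close> is positive,
  \<open>dim_cartan\<close> also makes \<open>H\<close> finite-dimensional.
\<close>

locale kac_moody_algebra = complex_lie_algebra scl br
  for scl :: "complex \<Rightarrow> 'g::ab_group_add \<Rightarrow> 'g" and br +
  fixes A :: "int^'i^'i"
    and H :: "'g set"
    and coroot :: "'i \<Rightarrow> 'g"
    and \<alpha> :: "'i \<Rightarrow> 'g \<Rightarrow> complex"
    and e f :: "'i \<Rightarrow> 'g"
  assumes gcm: "generalized_cartan_matrix A"
    and subspace_cartan: "subspace H"
    and dim_cartan: "dim H = 2 * CARD('i) - rank (real_matrix A)"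
    and coroot_in_cartan: "coroot i \<in> H"
    and coroots_independent: "(\<Sum>i\<in>UNIV. scl (c i) (coroot i)) = 0 \<Longrightarrow> c i = 0"
    and simple_root_in_dual: "\<alpha> i \<in> dual_space scl H"
    and simple_roots_independent: "(\<And>h. (\<Sum>i\<in>UNIV. c i * \<alpha> i h) = 0) \<Longrightarrow> c i = 0"
    and cartan_matrix: "\<alpha> j (coroot i) = of_int (A $ i $ j)"
    and br_cartan: "h \<in> H \<Longrightarrow> h' \<in> H \<Longrightarrow> br h h' = 0"
    and br_cartan_e: "h \<in> H \<Longrightarrow> br h (e i) = scl (\<alpha> i h) (e i)"
    and br_cartan_f: "h \<in> H \<Longrightarrow> br h (f i) = scl (- \<alpha> i h) (f i)"
    and br_e_f: "br (e i) (f j) = (if i = j then coroot i else 0)"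
    and generated: "lie_subalgebra S \<Longrightarrow> H \<union> range e \<union> range f \<subseteq> S \<Longrightarrow> S = UNIV"
    and no_ideals: "lie_ideal N \<Longrightarrow> N \<inter> H = {0} \<Longrightarrow> N = {0}"

definition finite_or_affine_type ::
  "(complex \<Rightarrow> 'g::ab_group_add \<Rightarrow> 'g) \<Rightarrow> ('g \<Rightarrow> 'g \<Rightarrow> 'g) \<Rightarrow> int^'i^'i \<Rightarrow> bool" where
  "finite_or_affine_type scl br A \<longleftrightarrow>
     (fin_dim scl \<and> simple_lie_algebra scl br) \<or> affine_cartan_matrix A"


section \<open>Roots\<close>

definition nat_span :: "('g \<Rightarrow> complex) set \<Rightarrow> ('g \<Rightarrow> complex) set" where
  "nat_span S = {(\<lambda>h. \<Sum>s\<in>F. of_nat (n s) * s h) | F (n :: ('g \<Rightarrow> complex) \<Rightarrow> nat).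
     finite F \<and> F \<subseteq> S}"

definition int_span :: "('g \<Rightarrow> complex) set \<Rightarrow> ('g \<Rightarrow> complex) set" where
  "int_span S = {(\<lambda>h. \<Sum>s\<in>F. of_int (n s) * s h) | F (n :: ('g \<Rightarrow> complex) \<Rightarrow> int).
     finite F \<and> F \<subseteq> S}"

definition set_diff :: "('g \<Rightarrow> complex) set \<Rightarrow> ('g \<Rightarrow> complex) set \<Rightarrow> ('g \<Rightarrow> complex) set"
    (infixl \<open>\<ominus>\<^sub>s\<close> 65) where
  "X \<ominus>\<^sub>s Y = {(\<lambda>h. a h - b h) | a b. a \<in> X \<and> b \<in> Y}"

definition roots ::
  "(complex \<Rightarrow> 'g::ab_group_add \<Rightarrow> 'g) \<Rightarrow> ('g \<Rightarrow> 'g \<Rightarrow> 'g) \<Rightarrow> 'g set \<Rightarrow> ('g \<Rightarrow> complex) set" where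
  "roots scl br H = {\<beta> \<in> dual_space scl H. \<beta> \<noteq> (\<lambda>_. 0) \<and>
     (\<exists>x. x \<noteq> 0 \<and> (\<forall>h\<in>H. br h x = scl (\<beta> h) x))}"

definition positive_roots ::
  "(complex \<Rightarrow> 'g::ab_group_add \<Rightarrow> 'g) \<Rightarrow> ('g \<Rightarrow> 'g \<Rightarrow> 'g) \<Rightarrow> 'g set \<Rightarrow>
   ('i \<Rightarrow> 'g \<Rightarrow> complex) \<Rightarrow> ('g \<Rightarrow> complex) set" where
  "positive_roots scl br H \<alpha> = roots scl br H \<inter> nat_span (range \<alpha>)"

text \<open>\<open>ht \<alpha> I x\<close> is the sum over \<open>I\<close> of the coefficients of \<open>x\<close> in the basis \<open>\<alpha>\<close> of its span.\<close>

definition root_coeffs ::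
  "('i::finite \<Rightarrow> 'g \<Rightarrow> complex) \<Rightarrow> ('g \<Rightarrow> complex) \<Rightarrow> 'i \<Rightarrow> complex" where
  "root_coeffs \<alpha> x = (THE c. x = (\<lambda>h. \<Sum>i\<in>UNIV. c i * \<alpha> i h))"

definition ht ::
  "('i::finite \<Rightarrow> 'g \<Rightarrow> complex) \<Rightarrow> 'i set \<Rightarrow> ('g \<Rightarrow> complex) \<Rightarrow> complex" where
  "ht \<alpha> I x = (\<Sum>i\<in>I. root_coeffs \<alpha> x i)"

lemma (in kac_moody_algebra) root_coeffs_eq:
  "root_coeffs \<alpha> (\<lambda>h. \<Sum>i\<in>UNIV. c i * \<alpha> i h) = c"
  unfolding root_coeffs_def
proof (rule the_equality)
  fix d assume d: "(\<lambda>h. \<Sum>i\<in>UNIV. c i * \<alpha> i h) = (\<lambda>h. \<Sum>i\<in>UNIV. d i * \<alpha> i h)"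
  have "(\<Sum>i\<in>UNIV. (d i - c i) * \<alpha> i h) = 0" for h
    using fun_cong[OF d, of h] by (simp add: left_diff_distrib sum_subtractf)
  then have "d i - c i = 0" for i
    by (rule simple_roots_independent)
  then show "d = c" by (simp add: fun_eq_iff)
qed simp

definition roots_ht1 ::
  "(complex \<Rightarrow> 'g::ab_group_add \<Rightarrow> 'g) \<Rightarrow> ('g \<Rightarrow> 'g \<Rightarrow> 'g) \<Rightarrow> 'g set \<Rightarrow>
   ('i::finite \<Rightarrow> 'g \<Rightarrow> complex) \<Rightarrow> 'i set \<Rightarrow> ('g \<Rightarrow> complex) set" where
  "roots_ht1 scl br H \<alpha> I = {\<beta> \<in> roots scl br H. ht \<alpha> I \<beta> = 1}"

definition roots_on ::
  "(complex \<Rightarrow> 'g::ab_group_add \<Rightarrow> 'g) \<Rightarrow> ('g \<Rightarrow> 'g \<Rightarrow> 'g) \<Rightarrow> 'g set \<Rightarrow>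
   ('i \<Rightarrow> 'g \<Rightarrow> complex) \<Rightarrow> 'i set \<Rightarrow> ('g \<Rightarrow> complex) set" where
  "roots_on scl br H \<alpha> J = roots scl br H \<inter> int_span (\<alpha> ` J)"

definition positive_roots_on ::
  "(complex \<Rightarrow> 'g::ab_group_add \<Rightarrow> 'g) \<Rightarrow> ('g \<Rightarrow> 'g \<Rightarrow> 'g) \<Rightarrow> 'g set \<Rightarrow>
   ('i \<Rightarrow> 'g \<Rightarrow> complex) \<Rightarrow> 'i set \<Rightarrow> ('g \<Rightarrow> complex) set" where
  "positive_roots_on scl br H \<alpha> J = roots_on scl br H \<alpha> J \<inter> positive_roots scl br H \<alpha>"


section \<open>Highest weight modules\<close>

definition highest_weight_module ::
  "(complex \<Rightarrow> 'g::ab_group_add \<Rightarrow> 'g) \<Rightarrow> ('g \<Rightarrow> 'g \<Rightarrow> 'g) \<Rightarrow> 'g set \<Rightarrow> ('i \<Rightarrow> 'g) \<Rightarrow>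
   (complex \<Rightarrow> 'v::ab_group_add \<Rightarrow> 'v) \<Rightarrow> ('g \<Rightarrow> 'v \<Rightarrow> 'v) \<Rightarrow> ('g \<Rightarrow> complex) \<Rightarrow> bool" where
  "highest_weight_module scl br H e smul act lam \<longleftrightarrow> lie_module scl br smul act \<and>
     (\<exists>v. v \<noteq> 0 \<and> (\<forall>h\<in>H. act h v = smul (lam h) v) \<and> (\<forall>i. act (e i) v = 0) \<and>
       (\<forall>U. lie_module.submodule smul act U \<and> v \<in> U \<longrightarrow> U = UNIV))"

definition weights ::
  "(complex \<Rightarrow> 'g::ab_group_add \<Rightarrow> 'g) \<Rightarrow> 'g set \<Rightarrow>
   (complex \<Rightarrow> 'v::ab_group_add \<Rightarrow> 'v) \<Rightarrow> ('g \<Rightarrow> 'v \<Rightarrow> 'v) \<Rightarrow> ('g \<Rightarrow> complex) set" where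
  "weights scl H smul act = {\<mu> \<in> dual_space scl H.
     \<exists>v. v \<noteq> 0 \<and> (\<forall>h\<in>H. act h v = smul (\<mu> h) v)}"

definition integrable_nodes :: "('i \<Rightarrow> 'g) \<Rightarrow> ('g \<Rightarrow> complex) \<Rightarrow> 'i set" where
  "integrable_nodes coroot lam = {j. lam (coroot j) \<in> \<nat>}"

definition weights_on ::
  "(complex \<Rightarrow> 'g::ab_group_add \<Rightarrow> 'g) \<Rightarrow> 'g set \<Rightarrow> ('i \<Rightarrow> 'g \<Rightarrow> complex) \<Rightarrow>
   (complex \<Rightarrow> 'v::ab_group_add \<Rightarrow> 'v) \<Rightarrow> ('g \<Rightarrow> 'v \<Rightarrow> 'v) \<Rightarrow> ('g \<Rightarrow> complex) \<Rightarrow> 'i set \<Rightarrow>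
   ('g \<Rightarrow> complex) set" where
  "weights_on scl H \<alpha> smul act lam J =
     ({lam} \<ominus>\<^sub>s nat_span (\<alpha> ` J)) \<inter> weights scl H smul act"

end

theory Submission
  imports Defs
begin

text \<open>
  Write \<open>J = J\<^sub>\<lambda>\<close>. Moving each lowering operator \<open>f\<^sub>j\<close>, \<open>j
  \<in> J\<close>, to the right, \<open>V\<close> is spanned by vectors \<open>x\<^sub>1 \<dots> x\<^sub>m
  u\<close>, where \<open>u\<close> is a word in the \<open>f\<^sub>j\<close> applied to the highest weight
  vector and every \<open>x\<^sub>k\<close> is a root vector for the negative of a root of height
  \<open>1\<close> off \<open>J\<close>. This gives one inclusion, and the adjoint version of the argument gives
  the equality of the two cones.

  For the other inclusion let \<open>\<gamma> = \<mu> - \<Sum>\<beta>\<^sub>k\<close> be a maximal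
  counterexample over all quotients of \<open>V\<close>, \<open>w\<close> a weight vector of weight
  \<open>\<mu>\<close>, and pass to \<open>V/L\<close> with \<open>L\<close> maximal among the submodules
  avoiding \<open>w\<close>. If \<open>\<gamma> + \<alpha>\<^sub>i\<close> lies in the right-hand side, it is a
  weight by maximality of \<open>\<gamma>\<close>, and \<open>f\<^sub>i\<close> kills its weight space in
  \<open>V/L\<close>; as the \<open>f\<^sub>i\<close>-nilpotent vectors form a submodule, maximality of
  \<open>L\<close> makes \<open>f\<^sub>i\<close> nilpotent on \<open>w\<close>. For \<open>i \<in> J\<close>
  this shows that \<open>s\<^sub>i \<mu>\<close> is a weight, so \<open>s\<^sub>i \<gamma>\<close> lies in the
  right-hand side; \<open>\<langle>\<gamma>, \<alpha>\<^sub>i\<^sup>\<or>\<rangle> < 0\<close> since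
  \<open>f\<^sub>i\<close> kills weight \<open>\<gamma> + \<alpha>\<^sub>i\<close>, so \<open>s\<^sub>i
  \<gamma>\<close> is a weight by maximality, and then so is \<open>\<gamma>\<close>, a contradiction. Hence no
  \<open>\<gamma> + \<alpha>\<^sub>j\<close> with \<open>j \<in> J\<close> lies in the right-hand side, which
  forces \<open>\<mu> = \<lambda>\<close> and all \<open>\<beta>\<^sub>k\<close> simple. But for
  \<open>\<beta>\<^sub>k = \<alpha>\<^sub>i\<close>, \<open>i \<notin> J\<close>, the same argument makes
  \<open>f\<^sub>i\<close> nilpotent on the highest weight vector, which is impossible as
  \<open>\<langle>\<lambda>, \<alpha>\<^sub>i\<^sup>\<or>\<rangle>\<close> is not a natural number.
\<close>

section \<open>Modules and \<open>sl\<^sub>2\<close>-triples\<close>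

context complex_lie_algebra
begin

lemma br_zero_left [simp]: "br 0 x = 0"
  using br_add_left[of 0 0 x] by simp

lemma br_zero_right [simp]: "br x 0 = 0"
  using br_add_right[of x 0 0] by simp

lemma br_minus_left: "br (- x) y = - br x y"
  using br_add_left[of x "- x" y] by (simp add: eq_neg_iff_add_eq_0 add.commute)

lemma br_minus_right: "br x (- y) = - br x y"
  using br_add_right[of x y "- y"] by (simp add: eq_neg_iff_add_eq_0 add.commute)

lemma br_swap: "br x y = - br y x"
proof -
  have "br (x + y) (x + y) = 0" by (rule br_self)
  then have "br x y + br y x = 0"
    unfolding br_add_left br_add_right[of _ x y] by (simp add: br_self add.commute)
  then show ?thesis by (rule eq_neg_iff_add_eq_0[THEN iffD2])
qed

lemma br_leibniz: "br (br x y) z = br x (br y z) - br y (br x z)"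
  using jacobi[of x y z] br_swap[of z "br x y"] br_swap[of z x]
  by (simp add: br_minus_right algebra_simps eq_neg_iff_add_eq_0)

text \<open>The Jacobi identity in the form \<open>br_leibniz\<close> is \<open>act_br\<close> for
  the adjoint action, so every module lemma also applies to the algebra acting on itself.\<close>

lemma lie_module_adjoint: "lie_module scl br scl br"
  by unfold_locales
    (simp_all add: br_add_left br_add_right br_scale_left br_scale_right br_leibniz)

end

context lie_module
begin

lemma act_zero_left [simp]: "act 0 v = 0"
  using act_add_left[of 0 0 v] by simp

lemma act_zero_right [simp]: "act x 0 = 0"
  using act_add_right[of x 0 0] by simp

lemma act_minus_left: "act (- x) v = - act x v"
  using act_add_left[of x "- x" v] by (simp add: eq_neg_iff_add_eq_0 add.commute)

lemma act_minus_right: "act x (- v) = - act x v"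
  using act_add_right[of x v "- v"] by (simp add: eq_neg_iff_add_eq_0 add.commute)

lemma act_diff_right: "act x (v - w) = act x v - act x w"
  using act_add_right[of x v "- w"] by (simp add: act_minus_right)

lemma act_sum_right: "act x (sum g K) = (\<Sum>k\<in>K. act x (g k))"
  by (induction K rule: infinite_finite_induct) (simp_all add: act_add_right)

lemma act_swap: "act x (act y v) = act (br x y) v + act y (act x v)"
  by (simp add: act_br)

lemma pow_zero [simp]: "(act x ^^ n) 0 = 0"
  by (induction n) simp_all

lemma pow_add: "(act x ^^ n) (v + w) = (act x ^^ n) v + (act x ^^ n) w"
  by (induction n) (simp_all add: act_add_right)

lemma pow_scale: "(act x ^^ n) (smul c v) = smul c ((act x ^^ n) v)"
  by (induction n) (simp_all add: act_scale_right)

lemma submoduleD: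
  assumes "submodule N"
  shows "0 \<in> N" "v \<in> N \<Longrightarrow> w \<in> N \<Longrightarrow> v + w \<in> N" "v \<in> N \<Longrightarrow> w \<in> N \<Longrightarrow> v - w \<in> N"
    "v \<in> N \<Longrightarrow> smul c v \<in> N" "v \<in> N \<Longrightarrow> act x v \<in> N" "v \<in> N \<Longrightarrow> (act x ^^ n) v \<in> N"
proof -
  show "v \<in> N \<Longrightarrow> (act x ^^ n) v \<in> N"
    using assms by (induction n) (auto simp: submodule_def)
qed (use assms in \<open>auto simp: submodule_def M.subspace_0 M.subspace_add M.subspace_diff M.subspace_scale\<close>)

lemma submodule_zero: "submodule {0}"
  by (simp add: submodule_def M.subspace_def)

lemma act_span:
  assumes "\<And>b. b \<in> B \<Longrightarrow> act x b \<in> M.span C" and "v \<in> M.span B"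
  shows "act x v \<in> M.span C"
  using assms(2)
proof (induction rule: M.span_induct_alt)
  case base
  show ?case by (simp add: M.span_zero)
next
  case (step c b u)
  then show ?case
    using assms(1)[of b] by (simp add: act_add_right act_scale_right M.span_add M.span_scale)
qed

text \<open>Together with the axiom \<open>generated\<close>, this reduces invariance under the
  whole algebra to invariance under the Chevalley generators.\<close>

lemma lie_subalgebra_stabilizer:
  assumes "M.subspace U"
  shows "lie_subalgebra {x. \<forall>u\<in>U. act x u \<in> U}"
  unfolding lie_subalgebra_def subspace_def
  using M.subspace_0[OF assms] M.subspace_add[OF assms] M.subspace_scale[OF assms]
    M.subspace_diff[OF assms]
  by (auto simp: act_add_left act_scale_left act_br)

text \<open>Quotient modules are never formed: a submodule \<open>N\<close> stands for V/N, and
  membership in \<open>N\<close> for vanishing there. These are the vectors on which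
  \<open>a\<close> is nilpotent in V/N.\<close>

definition nil_part :: "'g \<Rightarrow> 'v set \<Rightarrow> 'v set" where
  "nil_part a N = {x. \<exists>n. (act a ^^ n) x \<in> N}"

lemma pow_mono_submodule:
  assumes "submodule N" "(act a ^^ m) x \<in> N" "m \<le> n"
  shows "(act a ^^ n) x \<in> N"
proof -
  have "(act a ^^ n) x = (act a ^^ (n - m)) ((act a ^^ m) x)"
    using assms(3) by (metis funpow_add le_add_diff_inverse2 o_apply)
  then show ?thesis using submoduleD(6)[OF assms(1,2)] by simp
qed

text \<open>By the Leibniz rule, a^(n+m) applied to \<open>act y x\<close> is a sum of terms (ad
  a)^p y . a^q x with p + q = n + m, and each has p \<ge> n or q \<ge> m. Moving one
  \<open>a\<close> past \<open>y\<close> at a time, by induction on n + m, avoids binomial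
  coefficients.\<close>

lemma pow_act_in_submodule:
  assumes "submodule N"
  shows "(br a ^^ n) y = 0 \<Longrightarrow> (act a ^^ m) x \<in> N \<Longrightarrow> (act a ^^ (n + m)) (act y x) \<in> N"
proof (induction "n + m" arbitrary: n m x y)
  case 0
  then show ?case using submoduleD[OF assms] by simp
next
  case (Suc k)
  consider "n = 0" | "m = 0" | n' m' where "n = Suc n'" "m = Suc m'"
    by (cases n; cases m) auto
  then show ?case
  proof cases
    case 1
    then show ?thesis using Suc.prems submoduleD(1)[OF assms] by simp
  next
    case 2
    then show ?thesis using Suc.prems submoduleD(5,6)[OF assms] by simp
  next
    case 3
    have 1: "(act a ^^ k) (act (br a y) x) \<in> N"
      using Suc.hyps(1)[of n' m "br a y" x] Suc.hyps(2) Suc.prems 3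
      by (simp add: funpow_swap1)
    have 2: "(act a ^^ k) (act y (act a x)) \<in> N"
      using Suc.hyps(1)[of n m' y "act a x"] Suc.hyps(2) Suc.prems 3
      by (simp add: funpow_swap1)
    have "(act a ^^ Suc k) (act y x) = (act a ^^ k) (act (br a y) x + act y (act a x))"
      using act_swap[of a y x] by (simp add: funpow_swap1)
    also have "\<dots> \<in> N"
      using 1 2 submoduleD(2)[OF assms] by (simp add: pow_add)
    finally show ?thesis using Suc.hyps(2) by simp
  qed
qed

lemma submodule_nil_part:
  assumes "submodule N" and nil: "\<And>y. \<exists>n. (br a ^^ n) y = 0"
  shows "submodule (nil_part a N)"
  unfolding submodule_def M.subspace_def
proof (intro conjI ballI allI)
  show "0 \<in> nil_part a N"
    using submoduleD(1)[OF assms(1)] by (auto simp: nil_part_def)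
next
  fix x y assume "x \<in> nil_part a N" "y \<in> nil_part a N"
  then obtain m n where "(act a ^^ m) x \<in> N" "(act a ^^ n) y \<in> N"
    by (auto simp: nil_part_def)
  then have "(act a ^^ (max m n)) (x + y) \<in> N"
    by (simp add: pow_add submoduleD(2) pow_mono_submodule assms(1))
  then show "x + y \<in> nil_part a N" by (auto simp: nil_part_def)
next
  fix c x assume "x \<in> nil_part a N"
  then show "smul c x \<in> nil_part a N"
    using submoduleD(4)[OF assms(1)] by (auto simp: nil_part_def pow_scale)
next
  fix y x assume "x \<in> nil_part a N"
  then show "act y x \<in> nil_part a N"
    using pow_act_in_submodule[OF assms(1)] nil[of y] by (fastforce simp: nil_part_def)
qed

lemma subset_nil_part: "N \<subseteq> nil_part a N"
  by (auto simp: nil_part_def intro: exI[of _ 0])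

text \<open>Applying \<open>h0\<close> minus the scalar \<open>\<kappa> k0 h0\<close> kills the
  \<open>k0\<close> summand and multiplies the whole sum by the nonzero scalar
  \<open>\<mu> h0 - \<kappa> k0 h0\<close>; induction makes this multiple zero. The weights of the
  summands may coincide, they only have to differ from \<mu>.\<close>

lemma sum_wt_vec_eq_0:
  assumes "finite K"
    and "\<And>k h. k \<in> K \<Longrightarrow> h \<in> H \<Longrightarrow> act h (y k) = smul (\<kappa> k h) (y k)"
    and "\<And>k. k \<in> K \<Longrightarrow> \<exists>h\<in>H. \<kappa> k h \<noteq> \<mu> h"
    and "\<And>h. h \<in> H \<Longrightarrow> act h (\<Sum>k\<in>K. y k) = smul (\<mu> h) (\<Sum>k\<in>K. y k)"
  shows "(\<Sum>k\<in>K. y k) = 0"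
  using assms
proof (induction K arbitrary: y rule: finite_induct)
  case empty
  then show ?case by simp
next
  case (insert k0 K)
  let ?z = "\<Sum>k\<in>insert k0 K. y k"
  obtain h0 where h0: "h0 \<in> H" "\<kappa> k0 h0 \<noteq> \<mu> h0"
    using insert.prems(2)[of k0] by auto
  define y' where "y' k = smul (\<kappa> k h0 - \<kappa> k0 h0) (y k)" for k
  have z: "(\<Sum>k\<in>K. y' k) = smul (\<mu> h0 - \<kappa> k0 h0) ?z"
  proof -
    have "(\<Sum>k\<in>insert k0 K. y' k) = (\<Sum>k\<in>insert k0 K. act h0 (y k) - smul (\<kappa> k0 h0) (y k))"
      using insert.prems(1) h0(1)
      by (intro sum.cong) (auto simp: y'_def M.scale_left_diff_distrib)
    also have "\<dots> = act h0 ?z - smul (\<kappa> k0 h0) ?z"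
      by (simp only: sum_subtractf act_sum_right M.scale_sum_right)
    also have "\<dots> = smul (\<mu> h0 - \<kappa> k0 h0) ?z"
      using insert.prems(3)[OF h0(1)] by (simp add: M.scale_left_diff_distrib)
    finally show ?thesis using insert.hyps by (simp add: y'_def)
  qed
  have "(\<Sum>k\<in>K. y' k) = 0"
  proof (rule insert.IH)
    fix h assume h: "h \<in> H"
    show "act h (\<Sum>k\<in>K. y' k) = smul (\<mu> h) (\<Sum>k\<in>K. y' k)"
      unfolding z act_scale_right insert.prems(3)[OF h]
      by (simp add: M.scale_scale mult.commute)
  qed (use insert.prems in \<open>auto simp: y'_def act_scale_right M.scale_scale mult.commute\<close>)
  then show ?case using z h0 by simp
qed

text \<open>In a combination of elements of \<open>B\<close> equal to \<open>x\<close>, the terms of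
  weight other than \<mu> sum to a vector that has weight \<mu> too, which is zero by the preceding
  lemma.\<close>

lemma wt_vec_span:
  assumes x: "x \<in> M.span B" "\<And>h. h \<in> H \<Longrightarrow> act h x = smul (\<mu> h) x"
    and B: "\<And>b. b \<in> B \<Longrightarrow> \<exists>\<kappa>. \<forall>h\<in>H. act h b = smul (\<kappa> h) b"
  shows "x \<in> M.span {b \<in> B. \<forall>h\<in>H. act h b = smul (\<mu> h) b}"
proof -
  obtain t r where t: "finite t" "t \<subseteq> B" "x = (\<Sum>b\<in>t. smul (r b) b)"
    using x(1) unfolding M.span_explicit by blast
  define G where "G = {b \<in> t. \<forall>h\<in>H. act h b = smul (\<mu> h) b}"
  obtain \<kappa> where \<kappa>: "\<And>b h. b \<in> B \<Longrightarrow> h \<in> H \<Longrightarrow> act h b = smul (\<kappa> b h) b"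
    using B by metis
  have split: "(\<Sum>b\<in>t - G. smul (r b) b) = x - (\<Sum>b\<in>G. smul (r b) b)"
    unfolding t(3) using t(1) by (subst sum_diff) (auto simp: G_def)
  have "(\<Sum>b\<in>t - G. smul (r b) b) = 0"
  proof (rule sum_wt_vec_eq_0)
    show "finite (t - G)" using t(1) by simp
    show "act h (smul (r b) b) = smul (\<kappa> b h) (smul (r b) b)" if "b \<in> t - G" "h \<in> H" for b h
      using that \<kappa>[of b h] t(2) by (auto simp: act_scale_right M.scale_scale mult.commute)
    show "\<exists>h\<in>H. \<kappa> b h \<noteq> \<mu> h" if "b \<in> t - G" for b
      using that \<kappa>[of b] t(2) unfolding G_def by (auto simp: subset_iff)
    show "act h (\<Sum>b\<in>t - G. smul (r b) b) = smul (\<mu> h) (\<Sum>b\<in>t - G. smul (r b) b)"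
      if h: "h \<in> H" for h
    proof -
      have "act h (\<Sum>b\<in>G. smul (r b) b) = smul (\<mu> h) (\<Sum>b\<in>G. smul (r b) b)"
        unfolding act_sum_right M.scale_sum_right using h
        by (intro sum.cong) (auto simp: G_def act_scale_right M.scale_scale mult.commute)
      then show ?thesis
        unfolding split using x(2)[OF h] by (simp add: act_diff_right M.scale_right_diff_distrib)
    qed
  qed
  then have "x = (\<Sum>b\<in>G. smul (r b) b)" using split by simp
  also have "\<dots> \<in> M.span {b \<in> B. \<forall>h\<in>H. act h b = smul (\<mu> h) b}"
    using t(2) by (intro M.span_sum M.span_scale M.span_base) (auto simp: G_def)
  finally show ?thesis .
qed

text \<open>The recurring tool for finding weights: it trades an unknown weight vector for an
  explicit spanning element.\<close>

lemma wt_vec_span_nonmember: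
  assumes "x \<in> M.span B" "\<And>h. h \<in> H \<Longrightarrow> act h x = smul (\<mu> h) x"
    and "\<And>b. b \<in> B \<Longrightarrow> \<exists>\<kappa>. \<forall>h\<in>H. act h b = smul (\<kappa> h) b"
    and "M.subspace N" "x \<notin> N"
  obtains b where "b \<in> B" "\<And>h. h \<in> H \<Longrightarrow> act h b = smul (\<mu> h) b" "b \<notin> N"
proof -
  have "x \<in> M.span {b \<in> B. \<forall>h\<in>H. act h b = smul (\<mu> h) b}"
    using assms by (intro wt_vec_span)
  then have "\<not> {b \<in> B. \<forall>h\<in>H. act h b = smul (\<mu> h) b} \<subseteq> N"
    using M.span_minimal[OF _ assms(4)] assms(5) by blast
  then show ?thesis using that by blast
qed

end

section \<open>sl2-triples acting modulo a submodule\<close>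

locale sl2_triple = lie_module scl br smul act
  for scl :: "complex \<Rightarrow> 'g::ab_group_add \<Rightarrow> 'g" and br
    and smul :: "complex \<Rightarrow> 'v::ab_group_add \<Rightarrow> 'v" and act +
  fixes e0 h0 f0 :: 'g and N :: "'v set"
  assumes br_e0_f0: "br e0 f0 = h0"
    and br_h0_e0: "br h0 e0 = scl 2 e0"
    and br_h0_f0: "br h0 f0 = scl (- 2) f0"
    and submod: "submodule N"
begin

lemma sl2_triple_swap: "sl2_triple scl br smul act f0 (- h0) e0 N"
  by unfold_locales
    (use br_swap[of f0 e0] in \<open>simp_all add: br_e0_f0 br_minus_left br_h0_e0 br_h0_f0 submod\<close>)

lemma h0_pow_f0:
  assumes "act h0 x = smul c x"
  shows "act h0 ((act f0 ^^ n) x) = smul (c - 2 * of_nat n) ((act f0 ^^ n) x)"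
proof (induction n)
  case 0
  then show ?case using assms by simp
next
  case (Suc n)
  have "act h0 ((act f0 ^^ Suc n) x) =
      act (br h0 f0) ((act f0 ^^ n) x) + act f0 (act h0 ((act f0 ^^ n) x))"
    by (simp add: act_swap[of h0 f0])
  then show ?case
    by (simp add: Suc br_h0_f0 act_minus_left act_scale_left act_scale_right act_diff_right
        algebra_simps M.scale_left_diff_distrib M.scale_left_distrib)
qed

text \<open>The formula e f^(n+1) = f^(n+1) e + (n+1) f^n (h - n), evaluated at a vector of weight
  \<open>c\<close>.\<close>

lemma e0_pow_f0:
  assumes "act h0 x = smul c x"
  shows "act e0 ((act f0 ^^ Suc n) x) = (act f0 ^^ Suc n) (act e0 x) +
    smul (of_nat (Suc n) * (c - of_nat n)) ((act f0 ^^ n) x)"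
proof (induction n)
  case 0
  then show ?case using assms by (simp add: act_swap[of e0 f0] br_e0_f0)
next
  case (Suc n)
  have "act e0 ((act f0 ^^ Suc (Suc n)) x) =
      act h0 ((act f0 ^^ Suc n) x) + act f0 (act e0 ((act f0 ^^ Suc n) x))"
    using act_swap[of e0 f0 "(act f0 ^^ Suc n) x"] by (simp add: br_e0_f0)
  also have "\<dots> = smul (c - 2 * of_nat (Suc n)) ((act f0 ^^ Suc n) x) +
      (act f0 ((act f0 ^^ Suc n) (act e0 x)) +
       smul (of_nat (Suc n) * (c - of_nat n)) ((act f0 ^^ Suc n) x))"
    unfolding h0_pow_f0[OF assms] Suc by (simp add: act_add_right act_scale_right)
  also have "\<dots> = (act f0 ^^ Suc (Suc n)) (act e0 x) +
     smul ((c - 2 * of_nat (Suc n)) + of_nat (Suc n) * (c - of_nat n)) ((act f0 ^^ Suc n) x)"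
    by (simp add: M.scale_left_distrib add_ac)
  also have "(c - 2 * of_nat (Suc n)) + of_nat (Suc n) * (c - of_nat n) =
      of_nat (Suc (Suc n)) * (c - of_nat (Suc n))"
    by (simp add: algebra_simps)
  finally show ?case .
qed

lemma smul_in_submodule:
  assumes "smul c x \<in> N" "c \<noteq> 0"
  shows "x \<in> N"
  using submoduleD(4)[OF submod assms(1), of "inverse c"] assms(2) by simp

text \<open>Modulo \<open>N\<close> only the term with coefficient (n + 1) (c - n) survives in
  \<open>e0_pow_f0\<close>; it is a multiple of a vector outside \<open>N\<close>, so the
  coefficient is zero.\<close>

lemma pow_f0_singular:
  assumes "act h0 x = smul c x" "act e0 x \<in> N" "(act f0 ^^ Suc n) x \<in> N"
    and "(act f0 ^^ n) x \<notin> N"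
  shows "c = of_nat n"
proof -
  have "smul (of_nat (Suc n) * (c - of_nat n)) ((act f0 ^^ n) x) =
      act e0 ((act f0 ^^ Suc n) x) - (act f0 ^^ Suc n) (act e0 x)"
    unfolding e0_pow_f0[OF assms(1)] by simp
  also have "\<dots> \<in> N"
    by (rule submoduleD(3)[OF submod submoduleD(5)[OF submod assms(3)] submoduleD(6)[OF submod assms(2)]])
  finally have "of_nat (Suc n) * (c - of_nat n) = 0"
    using smul_in_submodule assms(4) by blast
  then show ?thesis using of_nat_eq_0_iff[of "Suc n", where 'a = complex] by simp
qed

lemma least_pow_f0:
  assumes "x \<notin> N" "(act f0 ^^ n) x \<in> N"
  obtains m where "(act f0 ^^ m) x \<notin> N" "(act f0 ^^ Suc m) x \<in> N"
proof -
  define m where "m = (LEAST n. (act f0 ^^ n) x \<in> N)"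
  have m: "(act f0 ^^ m) x \<in> N"
    unfolding m_def by (rule LeastI[of _ n]) (rule assms(2))
  then obtain k where k: "m = Suc k"
    using assms(1) by (cases m) auto
  have "(act f0 ^^ k) x \<notin> N"
    using not_less_Least[of k "\<lambda>n. (act f0 ^^ n) x \<in> N"] k by (simp add: m_def)
  then show ?thesis using that m k by blast
qed

lemma singular_weight_nat:
  assumes "act h0 x = smul c x" "act e0 x \<in> N" "(act f0 ^^ n) x \<in> N" "x \<notin> N"
  shows "c \<in> \<nat>"
proof -
  obtain m where "(act f0 ^^ m) x \<notin> N" "(act f0 ^^ Suc m) x \<in> N"
    using least_pow_f0[OF assms(4,3)] .
  then have "c = of_nat m" using pow_f0_singular[OF assms(1,2)] by blast
  then show ?thesis by simp
qed

text \<open>Induction on the nilpotency order of e on \<open>x\<close>: first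
  \<open>act e0 x\<close> vanishes in V/N. If \<open>x\<close> did not, it would be singular of
  weight p, the last nonzero vector of its f-string would be f^p x, and this is assumed to
  vanish.\<close>

lemma pow_f0_injective:
  assumes "act h0 x = smul (of_nat p) x" "(act e0 ^^ k) x \<in> N" "(act f0 ^^ p) x \<in> N"
  shows "x \<in> N"
  using assms
proof (induction k arbitrary: x p)
  case 0
  then show ?case by simp
next
  case (Suc k)
  have h: "act h0 (act e0 x) = smul (of_nat (p + 2)) (act e0 x)"
    using Suc.prems(1) by (simp add: act_swap[of h0 e0] br_h0_e0 act_scale_left act_scale_right
        M.scale_left_distrib)
  have f: "(act f0 ^^ m) x \<in> N" if "m \<ge> p" for m
    using pow_mono_submodule[OF submod Suc.prems(3) that] .
  \<comment> \<open>\<open>act e0 x\<close> has weight p + 2, so the induction hypothesis asks for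
    the power p + 2 of \<open>f0\<close>. Commuting it past \<open>e0\<close> leaves only powers of
    \<open>f0\<close> on \<open>x\<close> of order at least p.\<close>
  have "(act f0 ^^ Suc (Suc p)) (act e0 x) = act e0 ((act f0 ^^ Suc (Suc p)) x) -
     smul (of_nat (Suc (Suc p)) * (of_nat p - of_nat (Suc p))) ((act f0 ^^ Suc p) x)"
    unfolding e0_pow_f0[OF Suc.prems(1), of "Suc p"] by simp
  also have "\<dots> \<in> N"
    by (intro submoduleD(3-5)[OF submod] f) simp_all
  finally have "act e0 x \<in> N"
    using Suc.IH[OF h] Suc.prems(2) by (simp add: funpow_swap1)
  show ?case
  proof (rule ccontr)
    assume "x \<notin> N"
    then obtain m where m: "(act f0 ^^ m) x \<notin> N" "(act f0 ^^ Suc m) x \<in> N"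
      using least_pow_f0[OF _ Suc.prems(3)] by blast
    then have "p = m"
      using pow_f0_singular[OF Suc.prems(1) \<open>act e0 x \<in> N\<close>] of_nat_eq_iff by blast
    then show False using m f by blast
  qed
qed

lemma lowest_weight_nat:
  assumes "act h0 x = smul c x" "act f0 x \<in> N" "(act e0 ^^ n) x \<in> N" "x \<notin> N"
  shows "- c \<in> \<nat>"
proof -
  interpret swap: sl2_triple scl br smul act f0 "- h0" e0 N by (rule sl2_triple_swap)
  show ?thesis
    using swap.singular_weight_nat[of x "- c"] assms by (simp add: act_minus_left)
qed

lemma pow_e0_injective:
  assumes "act h0 x = smul (- of_nat p) x" "(act f0 ^^ k) x \<in> N" "(act e0 ^^ p) x \<in> N"
  shows "x \<in> N"
proof -
  interpret swap: sl2_triple scl br smul act f0 "- h0" e0 N by (rule sl2_triple_swap)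
  show ?thesis
    using swap.pow_f0_injective[of x p] assms by (simp add: act_minus_left)
qed

text \<open>The last vector outside \<open>N\<close> in the f-string of \<open>x\<close> is a lowest
  weight vector of weight c - 2m, hence 2m - c is a natural number.\<close>

lemma nilpotent_weight_int:
  assumes h: "act h0 x = smul c x" and "(act f0 ^^ n) x \<in> N" "x \<notin> N"
    and e: "\<And>y. \<exists>k. (act e0 ^^ k) y \<in> N"
  shows "c \<in> \<int>"
proof -
  obtain m where m: "(act f0 ^^ m) x \<notin> N" "(act f0 ^^ Suc m) x \<in> N"
    using assms least_pow_f0 by blast
  have "- (c - 2 * of_nat m) \<in> \<nat>"
    using lowest_weight_nat[OF h0_pow_f0[OF h] _ _ m(1)] m(2) e by auto
  then obtain k where "- (c - 2 * of_nat m) = of_nat k"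
    by (auto elim: Nats_cases)
  then have "c = of_int (2 * int m - int k)" by (simp add: algebra_simps)
  then show ?thesis by simp
qed

end

text \<open>Generic in the action and in the family \<open>a\<close>, because words are formed in
  modules, in the adjoint representation and componentwise in g x g.\<close>

definition act_word :: "('g \<Rightarrow> 'v \<Rightarrow> 'v) \<Rightarrow> ('i \<Rightarrow> 'g) \<Rightarrow> 'i list \<Rightarrow> 'v \<Rightarrow> 'v" where
  "act_word act a ks x = foldr (\<lambda>i. act (a i)) ks x"

lemma act_word_simps [simp]:
  "act_word act a [] x = x"
  "act_word act a (k # ks) x = act (a k) (act_word act a ks x)"
  by (simp_all add: act_word_def)

section \<open>Chevalley generators and the triangular decomposition\<close>

lemma axis_int_0 [simp]: "axis i (0::int) = 0"
  by (simp add: vec_eq_iff axis_def)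

lemma act_word_prod:
  "act_word (\<lambda>x y. (br (fst x) (fst y), br (snd x) (snd y))) (\<lambda>i. (a i, b i)) ks (x, y) =
     (act_word br a ks x, act_word br b ks y)"
  by (induction ks) simp_all

text \<open>The root lattice is handled through integer coefficient vectors, on which signs,
  supports and heights can be read off; \<open>rt\<close> turns them into functionals.\<close>

definition word_wt :: "'i list \<Rightarrow> int^'i::finite" where
  "word_wt ks = (\<Sum>k\<leftarrow>ks. axis k 1)"

lemma word_wt_simps [simp]:
  "word_wt [] = 0"
  "word_wt (k # ks) = axis k 1 + word_wt ks"
  by (simp_all add: word_wt_def)

lemma word_wt_nth: "word_wt ks $ i = int (count_list ks i)"
  by (induction ks) (auto simp: axis_def)

lemma word_wt_nonneg: "word_wt ks $ i \<ge> 0"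
  by (simp add: word_wt_nth)

lemma word_wt_eq_0_iff: "word_wt ks = 0 \<longleftrightarrow> ks = []"
  by (cases ks) (auto simp: vec_eq_iff word_wt_nth intro!: exI[of _ "hd ks"])

text \<open>Only the Chevalley relations are kept, so that g x g with the pairs (e_i, f_i), (f_i,
  e_i) and (h, -h) is an instance besides g itself.\<close>

locale chevalley_system = complex_lie_algebra scl br
  for scl :: "complex \<Rightarrow> 'g::ab_group_add \<Rightarrow> 'g" and br +
  fixes H :: "'g set"
    and coroot :: "'i::finite \<Rightarrow> 'g"
    and \<alpha> :: "'i \<Rightarrow> 'g \<Rightarrow> complex"
    and e f :: "'i \<Rightarrow> 'g"
  assumes cartan_subspace: "subspace H"
    and coroot_cartan: "coroot i \<in> H"
    and cartan_commute: "h \<in> H \<Longrightarrow> h' \<in> H \<Longrightarrow> br h h' = 0"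
    and cartan_e: "h \<in> H \<Longrightarrow> br h (e i) = scl (\<alpha> i h) (e i)"
    and cartan_f: "h \<in> H \<Longrightarrow> br h (f i) = scl (- \<alpha> i h) (f i)"
    and e_f: "br (e i) (f j) = (if i = j then coroot i else 0)"
begin

lemma chevalley_system_swap:
  "chevalley_system scl br H (\<lambda>i. - coroot i) (\<lambda>i h. - \<alpha> i h) f e"
proof unfold_locales
  show "br (f i) (e j) = (if i = j then - coroot i else 0)" for i j
    using br_swap[of "f i" "e j"] by (simp add: e_f)
qed (simp_all add: cartan_subspace subspace_neg coroot_cartan cartan_commute cartan_e cartan_f)

definition rt :: "int^'i \<Rightarrow> 'g \<Rightarrow> complex" where
  "rt n h = (\<Sum>i\<in>UNIV. of_int (n $ i) * \<alpha> i h)"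

lemma rt_simps [simp]:
  "rt 0 h = 0" "rt (m + n) h = rt m h + rt n h" "rt (m - n) h = rt m h - rt n h"
  "rt (- n) h = - rt n h" "rt (axis i c) h = of_int c * \<alpha> i h"
proof -
  show "rt (axis i c) h = of_int c * \<alpha> i h"
    by (simp add: rt_def axis_def if_distrib[of of_int] mult_delta_left sum.delta cong: if_cong)
qed (simp_all add: rt_def algebra_simps sum.distrib sum_subtractf sum_negf)

end

section \<open>Weight vectors of a module over a Chevalley system\<close>

locale chevalley_module = chevalley_system scl br H coroot \<alpha> e f + lie_module scl br smul act
  for scl :: "complex \<Rightarrow> 'g::ab_group_add \<Rightarrow> 'g" and br
    and H :: "'g set" and coroot :: "'i::finite \<Rightarrow> 'g" and \<alpha> e f
    and smul :: "complex \<Rightarrow> 'v::ab_group_add \<Rightarrow> 'v" and act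
begin

text \<open>The zero vector satisfies this for every weight, so nonvanishing is always stated
  separately.\<close>

definition wt_vec :: "('g \<Rightarrow> complex) \<Rightarrow> int^'i \<Rightarrow> 'v \<Rightarrow> bool" where
  "wt_vec lam n x \<longleftrightarrow> (\<forall>h\<in>H. act h x = smul (lam h + rt n h) x)"

lemma wt_vec_e: "wt_vec lam n x \<Longrightarrow> wt_vec lam (n + axis i 1) (act (e i) x)"
  by (auto simp: wt_vec_def act_swap[of _ "e i"] cartan_e act_add_right act_scale_left act_scale_right
      M.scale_left_distrib add_ac)

lemma wt_vec_f: "wt_vec lam n x \<Longrightarrow> wt_vec lam (n - axis i 1) (act (f i) x)"
  by (auto simp: wt_vec_def act_swap[of _ "f i"] cartan_f act_add_right act_scale_left act_minus_left
      act_scale_right M.scale_left_distrib M.scale_left_diff_distrib algebra_simps)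

lemma wt_vec_pow_f: "wt_vec lam n x \<Longrightarrow> wt_vec lam (n - axis i (int k)) ((act (f i) ^^ k) x)"
proof (induction k)
  case 0
  then show ?case by simp
next
  case (Suc k)
  have "n - axis i (int (Suc k)) = (n - axis i (int k)) - axis i 1"
    by (simp add: vec_eq_iff axis_def)
  then show ?case using wt_vec_f[OF Suc.IH[OF Suc.prems], of i] by (simp only: funpow.simps o_apply)
qed

lemma wt_vec_pow_e: "wt_vec lam n x \<Longrightarrow> wt_vec lam (n + axis i (int k)) ((act (e i) ^^ k) x)"
proof (induction k)
  case 0
  then show ?case by simp
next
  case (Suc k)
  have "n + axis i (int (Suc k)) = (n + axis i (int k)) + axis i 1"
    by (simp add: vec_eq_iff axis_def)
  then show ?case using wt_vec_e[OF Suc.IH[OF Suc.prems], of i] by (simp only: funpow.simps o_apply)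
qed

lemma wt_vec_word_f: "wt_vec lam n x \<Longrightarrow> wt_vec lam (n - word_wt ks) (act_word act f ks x)"
  using wt_vec_f by (induction ks) (fastforce simp: algebra_simps)+

lemma wt_vec_word_e: "wt_vec lam n x \<Longrightarrow> wt_vec lam (n + word_wt ks) (act_word act e ks x)"
  using wt_vec_e by (induction ks) (fastforce simp: algebra_simps)+

lemma act_cartan_span:
  assumes "h \<in> H" "\<And>b. b \<in> B \<Longrightarrow> \<exists>lam n. wt_vec lam n b" "x \<in> M.span B"
  shows "act h x \<in> M.span B"
proof (rule act_span[OF _ assms(3)])
  fix b assume b: "b \<in> B"
  then obtain lam n where "wt_vec lam n b" using assms(2) by blast
  then show "act h b \<in> M.span B"
    using assms(1) b by (simp add: wt_vec_def M.span_scale M.span_base)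
qed

lemma wt_vec_span_elem:
  assumes "x \<in> M.span B" "wt_vec lam n x" "\<And>b. b \<in> B \<Longrightarrow> \<exists>m. wt_vec lam m b"
    and "M.subspace N" "x \<notin> N"
  obtains b where "b \<in> B" "wt_vec lam n b" "b \<notin> N"
proof (rule wt_vec_span_nonmember[OF assms(1) _ _ assms(4,5)])
  show "act h x = smul (lam h + rt n h) x" if "h \<in> H" for h
    using assms(2) that by (simp add: wt_vec_def)
  show "\<exists>\<kappa>. \<forall>h\<in>H. act h b = smul (\<kappa> h) b" if b: "b \<in> B" for b
  proof -
    obtain m where "wt_vec lam m b" using assms(3)[OF b] ..
    then show ?thesis unfolding wt_vec_def by (intro exI[of _ "\<lambda>h. lam h + rt m h"])
  qed
qed (use that in \<open>auto simp: wt_vec_def\<close>)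

text \<open>Moving \<open>e i\<close> to the right through a word produces commutators [e_i, f_k],
  which are zero or co-roots acting by scalars on the remaining word, until \<open>e i\<close> meets
  \<open>v\<close> and kills it.\<close>

lemma span_word_f_stable:
  assumes v: "wt_vec lam n v" and ev: "\<And>i. act (e i) v = 0"
    and u: "u \<in> M.span (range (\<lambda>ks. act_word act f ks v))"
  shows "h \<in> H \<Longrightarrow> act h u \<in> M.span (range (\<lambda>ks. act_word act f ks v))"
    and "act (f i) u \<in> M.span (range (\<lambda>ks. act_word act f ks v))"
    and "act (e i) u \<in> M.span (range (\<lambda>ks. act_word act f ks v))"
proof -
  let ?U = "M.span (range (\<lambda>ks. act_word act f ks v))"
  have h: "act h u \<in> ?U" if "h \<in> H" "u \<in> ?U" for h u
    using act_cartan_span[OF that(1) _ that(2)] wt_vec_word_f[OF v] by blast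
  show "act h u \<in> ?U" if "h \<in> H" using h[OF that u] .
  have word: "act_word act f ks v \<in> ?U" for ks
    by (simp add: M.span_base)
  have f: "act (f i) u \<in> ?U" if "u \<in> ?U" for i u
  proof (rule act_span[OF _ that])
    fix b assume "b \<in> range (\<lambda>ks. act_word act f ks v)"
    then obtain ks where "b = act_word act f ks v" ..
    then show "act (f i) b \<in> ?U" using word[of "i # ks"] by simp
  qed
  then show "act (f i) u \<in> ?U" using u .
  have "act (e i) (act_word act f ks v) \<in> ?U" for ks
  proof (induction ks)
    case Nil
    then show ?case by (simp add: ev M.span_zero)
  next
    case (Cons k ks)
    have "act (br (e i) (f k)) (act_word act f ks v) \<in> ?U"
      using h[OF coroot_cartan word[of ks]] by (simp add: e_f M.span_zero)
    then show ?case
      using f[OF Cons.IH, of k] by (simp add: act_swap[of "e i"] M.span_add)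
  qed
  then show "act (e i) u \<in> ?U"
    using act_span[OF _ u, of "e i"] by auto
qed

end

section \<open>The span of \<open>H\<close> and the iterated brackets of generators\<close>

context chevalley_system
begin

lemma chevalley_module_adjoint: "chevalley_module scl br H coroot \<alpha> e f scl br"
  by (intro chevalley_module.intro chevalley_system_axioms lie_module_adjoint)

interpretation adj: chevalley_module scl br H coroot \<alpha> e f scl br
  by (rule chevalley_module_adjoint)

text \<open>Right-normed brackets, which in a Lie algebra span the subalgebra generated by the
  \<open>e i\<close>; likewise for the \<open>f i\<close>.\<close>

definition "e_words = (\<Union>k. range (\<lambda>ks. act_word br e ks (e k)))"
definition "f_words = (\<Union>k. range (\<lambda>ks. act_word br f ks (f k)))"

lemma wt_vec_e_gen: "adj.wt_vec (\<lambda>_. 0) (axis i 1) (e i)"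
  and wt_vec_f_gen: "adj.wt_vec (\<lambda>_. 0) (- axis i 1) (f i)"
  and wt_vec_cartan: "h \<in> H \<Longrightarrow> adj.wt_vec (\<lambda>_. 0) 0 h"
  by (simp_all add: adj.wt_vec_def cartan_e cartan_f cartan_commute)

lemma wt_vec_e_word: "adj.wt_vec (\<lambda>_. 0) (word_wt (ks @ [k])) (act_word br e ks (e k))"
  using adj.wt_vec_word_e[OF wt_vec_e_gen[of k], of ks]
  by (simp add: word_wt_def add.commute)

lemma wt_vec_f_word: "adj.wt_vec (\<lambda>_. 0) (- word_wt (ks @ [k])) (act_word br f ks (f k))"
  using adj.wt_vec_word_f[OF wt_vec_f_gen[of k], of ks]
  by (simp add: word_wt_def algebra_simps)

lemma e_word_Cons: "x \<in> e_words \<Longrightarrow> br (e i) x \<in> e_words"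
  and f_word_Cons: "x \<in> f_words \<Longrightarrow> br (f i) x \<in> f_words"
proof -
  show "br (e i) x \<in> e_words" if x: "x \<in> e_words"
  proof -
    obtain ks k where "x = act_word br e ks (e k)" using x by (auto simp: e_words_def)
    then have "br (e i) x = act_word br e (i # ks) (e k)" by simp
    then show ?thesis unfolding e_words_def by blast
  qed
  show "br (f i) x \<in> f_words" if x: "x \<in> f_words"
  proof -
    obtain ks k where "x = act_word br f ks (f k)" using x by (auto simp: f_words_def)
    then have "br (f i) x = act_word br f (i # ks) (f k)" by simp
    then show ?thesis unfolding f_words_def by blast
  qed
qed

lemma gen_in_words: "e i \<in> e_words" "f i \<in> f_words"
proof -
  have "e i = act_word br e [] (e i)" "f i = act_word br f [] (f i)" by simp_all
  then show "e i \<in> e_words" "f i \<in> f_words"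
    unfolding e_words_def f_words_def by blast+
qed

text \<open>As \<open>e i\<close> moves inward, [e_i, f_j] is zero or acts on the rest of the word
  by a scalar, and the innermost bracket lands in \<open>H\<close>; this is where \<open>H\<close>
  enters the span.\<close>

lemma br_e_f_word:
  assumes "u \<in> f_words"
  shows "br (e i) u \<in> span (H \<union> f_words)"
proof -
  obtain ks k where u: "u = act_word br f ks (f k)"
    using assms unfolding f_words_def by blast
  have "br (e i) (act_word br f ks (f k)) \<in> span (H \<union> f_words)"
  proof (induction ks)
    case Nil
    then show ?case using coroot_cartan by (simp add: e_f span_zero span_base)
  next
    case (Cons j ks)
    let ?u = "act_word br f ks (f k)"
    have u: "?u \<in> f_words" by (auto simp: f_words_def)
    have "br (coroot j) ?u \<in> span (H \<union> f_words)"
      using wt_vec_f_word[of ks k] coroot_cartan[of j] u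
      by (simp add: adj.wt_vec_def span_scale span_neg span_base)
    then have 1: "br (br (e i) (f j)) ?u \<in> span (H \<union> f_words)"
      by (auto simp: e_f span_zero)
    have "br (f j) b \<in> span (H \<union> f_words)" if "b \<in> H \<union> f_words" for b
    proof (cases "b \<in> H")
      case True
      have "br (f j) b = scl (\<alpha> j b) (f j)"
        using cartan_f[OF True, of j] br_swap[of "f j" b] by simp
      then show ?thesis using gen_in_words by (simp add: span_scale span_base)
    next
      case False
      then show ?thesis using that f_word_Cons by (simp add: span_base)
    qed
    then have 2: "br (f j) (br (e i) ?u) \<in> span (H \<union> f_words)"
      using Cons.IH by (rule adj.act_span)
    show ?case
      using 1 2 adj.act_swap[of "e i" "f j" ?u] by (simp add: span_add)
  qed
  then show ?thesis using u by simp
qed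

lemma br_f_e_word:
  assumes "u \<in> e_words"
  shows "br (f i) u \<in> span (H \<union> e_words)"
proof -
  interpret swap: chevalley_system scl br H "\<lambda>i. - coroot i" "\<lambda>i h. - \<alpha> i h" f e
    by (rule chevalley_system_swap)
  have "swap.f_words = e_words" by (simp add: swap.f_words_def e_words_def)
  then show ?thesis using swap.br_e_f_word assms by simp
qed

text \<open>The stabilizer of the span is a Lie subalgebra containing \<open>H\<close>, all
  \<open>e i\<close> and all \<open>f i\<close>, hence all words, hence the span itself; that is
  closure under brackets.\<close>

lemma lie_subalgebra_triangular: "lie_subalgebra (span (H \<union> e_words \<union> f_words))"
proof -
  let ?T = "H \<union> e_words \<union> f_words"
  let ?S = "{x. \<forall>u\<in>span ?T. br x u \<in> span ?T}"
  have S: "lie_subalgebra ?S"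
    by (intro adj.lie_subalgebra_stabilizer subspace_span)
  have mono: "span (H \<union> e_words) \<subseteq> span ?T" "span (H \<union> f_words) \<subseteq> span ?T"
    by (auto intro!: span_mono)
  have stabI: "x \<in> ?S" if "\<And>b. b \<in> ?T \<Longrightarrow> br x b \<in> span ?T" for x
    using adj.act_span[of ?T x ?T] that by blast
  have wt: "\<exists>n. adj.wt_vec (\<lambda>_. 0) n b" if "b \<in> ?T" for b
    using that wt_vec_cartan wt_vec_e_word wt_vec_f_word
    by (auto simp: e_words_def f_words_def) blast+
  have H: "H \<subseteq> ?S"
    using adj.act_cartan_span[of _ ?T] wt by blast
  have e: "e i \<in> ?S" for i
  proof (rule stabI)
    fix b assume b: "b \<in> ?T"
    consider "b \<in> H" | "b \<in> e_words" | "b \<in> f_words" using b by blast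
    then show "br (e i) b \<in> span ?T"
    proof cases
      case 1
      have "br (e i) b = scl (- \<alpha> i b) (e i)"
        using cartan_e[OF 1, of i] br_swap[of "e i" b] by simp
      then show ?thesis using gen_in_words[of i] by (simp add: span_neg span_scale span_base)
    next
      case 2
      then show ?thesis using e_word_Cons by (simp add: span_base)
    next
      case 3
      then show ?thesis using br_e_f_word mono by blast
    qed
  qed
  have f: "f i \<in> ?S" for i
  proof (rule stabI)
    fix b assume b: "b \<in> ?T"
    consider "b \<in> H" | "b \<in> e_words" | "b \<in> f_words" using b by blast
    then show "br (f i) b \<in> span ?T"
    proof cases
      case 1
      have "br (f i) b = scl (\<alpha> i b) (f i)"
        using cartan_f[OF 1, of i] br_swap[of "f i" b] by simp
      then show ?thesis using gen_in_words[of i] by (simp add: span_scale span_base)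
    next
      case 2
      then show ?thesis using br_f_e_word mono by blast
    next
      case 3
      then show ?thesis using f_word_Cons by (simp add: span_base)
    qed
  qed
  have closed: "br x y \<in> ?S" if "x \<in> ?S" "y \<in> ?S" for x y
    using S that unfolding lie_subalgebra_def by blast
  have "act_word br e ks (e k) \<in> ?S" "act_word br f ks (f k) \<in> ?S" for ks k
    by (induction ks) (use e f closed in simp_all)
  then have "?T \<subseteq> ?S"
    using H unfolding e_words_def f_words_def by blast
  then have "span ?T \<subseteq> ?S"
    using S unfolding lie_subalgebra_def by (intro span_minimal) auto
  then show ?thesis
    unfolding lie_subalgebra_def using subspace_span by blast
qed

end

definition (in chevalley_system) root_vec :: "int^'i \<Rightarrow> 'g \<Rightarrow> bool" where
  "root_vec n x \<longleftrightarrow> (\<forall>h\<in>H. br h x = scl (rt n h) x)"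

lemma (in chevalley_system) wt_vec_adjoint:
  "chevalley_module.wt_vec H \<alpha> scl br (\<lambda>_. 0) n x \<longleftrightarrow> root_vec n x"
  by (simp add: chevalley_module.wt_vec_def[OF chevalley_module_adjoint] root_vec_def)

lemma (in chevalley_system)
  root_vec_e_word: "root_vec (word_wt (ks @ [k])) (act_word br e ks (e k))"
  and root_vec_f_word: "root_vec (- word_wt (ks @ [k])) (act_word br f ks (f k))"
  and root_vec_cartan: "h \<in> H \<Longrightarrow> root_vec 0 h"
  and root_vec_e: "root_vec (axis i 1) (e i)"
  and root_vec_f: "root_vec (- axis i 1) (f i)"
  using wt_vec_e_word wt_vec_f_word wt_vec_cartan wt_vec_e_gen wt_vec_f_gen
  unfolding wt_vec_adjoint by blast+

lemma (in chevalley_module) wt_vec_act: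
  "root_vec m y \<Longrightarrow> wt_vec lam n x \<Longrightarrow> wt_vec lam (n + m) (act y x)"
  by (auto simp: wt_vec_def root_vec_def act_swap[of _ y] act_add_right act_scale_left
      act_scale_right M.scale_left_distrib add_ac)

sublocale kac_moody_algebra \<subseteq> chevalley_system scl br H coroot \<alpha> e f
  by unfold_locales
    (fact subspace_cartan coroot_in_cartan br_cartan br_cartan_e br_cartan_f br_e_f)+

text \<open>With this symmetry of the axioms, results on the \<open>f i\<close> transfer to the
  \<open>e i\<close>.\<close>

lemma (in kac_moody_algebra) kac_moody_algebra_swap:
  "kac_moody_algebra scl br A H (\<lambda>i. - coroot i) (\<lambda>i h. - \<alpha> i h) f e"
proof -
  interpret swap: chevalley_system scl br H "\<lambda>i. - coroot i" "\<lambda>i h. - \<alpha> i h" f e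
    by (rule chevalley_system_swap)
  show ?thesis
  proof unfold_locales
    show "c i = 0" if "(\<Sum>i\<in>UNIV. scl (c i) (- coroot i)) = 0" for c i
      using coroots_independent[of c i] that by (simp add: sum_negf)
    show "c i = 0" if "\<And>h. (\<Sum>i\<in>UNIV. c i * - \<alpha> i h) = 0" for c i
      using simple_roots_independent[of c i] that by (simp add: sum_negf)
    show "(\<lambda>h. - \<alpha> i h) \<in> dual_space scl H" for i
      using simple_root_in_dual[of i] by (auto simp: dual_space_def)
    show "- \<alpha> j (- coroot i) = of_int (A $ i $ j)" for i j
    proof -
      have "\<alpha> j (scl (- 1) (coroot i)) = - 1 * \<alpha> j (coroot i)"
        using simple_root_in_dual[of j] coroot_in_cartan[of i] unfolding dual_space_def by blast
      then show ?thesis by (simp add: cartan_matrix)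
    qed
    show "S = UNIV" if "lie_subalgebra S" "H \<union> range f \<union> range e \<subseteq> S" for S
      using generated[OF that(1)] that(2) by blast
  qed (fact gcm dim_cartan subspace_cartan no_ideals swap.coroot_cartan swap.cartan_commute
      swap.cartan_e swap.cartan_f swap.e_f)+
qed

locale km_module = kac_moody_algebra scl br A H coroot \<alpha> e f + lie_module scl br smul act
  for scl :: "complex \<Rightarrow> 'g::ab_group_add \<Rightarrow> 'g" and br
    and A :: "int^'i^'i" and H :: "'g set" and coroot :: "'i \<Rightarrow> 'g" and \<alpha> e f
    and smul :: "complex \<Rightarrow> 'v::ab_group_add \<Rightarrow> 'v" and act

sublocale km_module \<subseteq> chevalley_module scl br H coroot \<alpha> e f smul act
  by unfold_locales

context kac_moody_algebra
begin

lemma km_module_adjoint: "km_module scl br A H coroot \<alpha> e f scl br"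
  by (intro km_module.intro kac_moody_algebra_axioms lie_module_adjoint)

text \<open>Simple roots are independent as functions on all of g; as they vanish off
  \<open>H\<close>, it is enough to test a combination on \<open>H\<close>.\<close>

lemma rt_eq_0D:
  assumes "\<And>h. h \<in> H \<Longrightarrow> rt n h = 0"
  shows "n = 0"
proof -
  have "\<alpha> i h = 0" if "h \<notin> H" for i h
    using simple_root_in_dual[of i] that by (simp add: dual_space_def)
  then have "rt n h = 0" for h
    using assms[of h] by (cases "h \<in> H") (auto simp: rt_def)
  then show ?thesis
    using simple_roots_independent[of "\<lambda>i. of_int (n $ i)"] by (auto simp: rt_def vec_eq_iff)
qed

definition pairing :: "'i \<Rightarrow> int^'i \<Rightarrow> int" where
  "pairing j n = (\<Sum>i\<in>UNIV. n $ i * A $ j $ i)"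

lemma rt_coroot: "rt n (coroot j) = of_int (pairing j n)"
  by (simp add: rt_def pairing_def cartan_matrix)

lemma pairing_simps [simp]:
  "pairing j (m + n) = pairing j m + pairing j n"
  "pairing j (m - n) = pairing j m - pairing j n"
  "pairing j 0 = 0" "pairing j (- n) = - pairing j n"
  "pairing j (axis i c) = c * A $ j $ i"
proof -
  show "pairing j (axis i c) = c * A $ j $ i"
    by (simp add: pairing_def axis_def mult_delta_left sum.delta)
qed (simp_all add: pairing_def algebra_simps sum.distrib sum_subtractf sum_negf)

lemma cartan_diag [simp]: "A $ i $ i = 2"
  using gcm by (simp add: generalized_cartan_matrix_def)

end

lemma (in km_module) wt_vec_unique:
  assumes "wt_vec lam m x" "wt_vec lam n x" "x \<noteq> 0"
  shows "m = n"
proof -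
  have "rt (m - n) h = 0" if "h \<in> H" for h
  proof -
    have "smul (lam h + rt m h) x = smul (lam h + rt n h) x"
      using assms that by (simp add: wt_vec_def)
    then show ?thesis using assms(3) by simp
  qed
  then have "m - n = 0" by (rule rt_eq_0D)
  then show ?thesis by simp
qed

lemma (in km_module) sl2_triple_simple:
  assumes "submodule N"
  shows "sl2_triple scl br smul act (e i) (coroot i) (f i) N"
  by unfold_locales
    (simp_all add: assms br_e_f br_cartan_e br_cartan_f coroot_in_cartan cartan_matrix)

lemma (in km_module) submoduleI_generators:
  assumes "M.subspace U" "\<And>x u. x \<in> H \<union> range e \<union> range f \<Longrightarrow> u \<in> U \<Longrightarrow> act x u \<in> U"
  shows "submodule U"
proof -
  have "{x. \<forall>u\<in>U. act x u \<in> U} = UNIV"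
    by (rule generated[OF lie_subalgebra_stabilizer[OF assms(1)]]) (use assms(2) in blast)
  then show ?thesis using assms(1) by (auto simp: submodule_def)
qed

lemma (in km_module) submodule_span_word_f:
  assumes "wt_vec lam n v" "\<And>i. act (e i) v = 0"
  shows "submodule (M.span (range (\<lambda>ks. act_word act f ks v)))"
  by (rule submoduleI_generators) (use span_word_f_stable[OF assms] in \<open>auto simp: M.subspace_span\<close>)

section \<open>Serre relations, local nilpotency and signs of roots\<close>

context kac_moody_algebra
begin

interpretation adj: km_module scl br A H coroot \<alpha> e f scl br
  by (rule km_module_adjoint)

lemma span_triangular: "span (H \<union> e_words \<union> f_words) = UNIV"
proof (rule generated[OF lie_subalgebra_triangular])
  show "H \<union> range e \<union> range f \<subseteq> span (H \<union> e_words \<union> f_words)"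
    using gen_in_words by (auto intro: span_base)
qed

text \<open>The ideal generated by \<open>x\<close> is spanned by words in the \<open>f i\<close>
  applied to \<open>x\<close>, all of nonzero negative weight. It meets \<open>H\<close>, which has
  weight zero, only in zero, so \<open>no_ideals\<close> applies.\<close>

lemma singular_vector_eq_0:
  assumes "root_vec (- word_wt ks) x" "ks \<noteq> []" "\<And>i. br (e i) x = 0"
  shows "x = 0"
proof -
  let ?B = "range (\<lambda>ls. act_word br f ls x)"
  have x: "adj.wt_vec (\<lambda>_. 0) (- word_wt ks) x"
    using assms(1) by (simp add: wt_vec_adjoint)
  have "adj.submodule (span ?B)"
    using x assms(3) by (rule adj.submodule_span_word_f)
  then have ideal: "lie_ideal (span ?B)"
    by (simp add: adj.submodule_def lie_ideal_def)
  have "h = 0" if h: "h \<in> span ?B" "h \<in> H" for h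
  proof (rule ccontr)
    assume "h \<noteq> 0"
    have "adj.wt_vec (\<lambda>_. 0) 0 h" using h(2) by (rule wt_vec_cartan)
    moreover have "\<exists>m. adj.wt_vec (\<lambda>_. 0) m b" if "b \<in> ?B" for b
      using that adj.wt_vec_word_f[OF x] by blast
    ultimately obtain b where b: "b \<in> ?B" "adj.wt_vec (\<lambda>_. 0) 0 b" "b \<notin> {0}"
      using adj.wt_vec_span_elem[OF h(1), of _ _ "{0}"] \<open>h \<noteq> 0\<close> by (metis singletonD subspace_single_0)
    then obtain ls where ls: "b = act_word br f ls x" by blast
    have "adj.wt_vec (\<lambda>_. 0) (- word_wt ks - word_wt ls) b"
      unfolding ls using adj.wt_vec_word_f[OF x] .
    then have "- word_wt ks - word_wt ls = 0"
      using adj.wt_vec_unique b(2,3) by blast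
    then have "word_wt ks + word_wt ls = 0"
      by (metis add_uminus_conv_diff minus_add_distrib neg_equal_0_iff_equal)
    then have "word_wt (ks @ ls) = 0"
      by (simp add: word_wt_def)
    then show False using assms(2) by (simp add: word_wt_eq_0_iff)
  qed
  then have "span ?B \<inter> H = {0}"
    using span_zero subspace_0[OF subspace_cartan] by blast
  then have "span ?B = {0}" by (rule no_ideals[OF ideal])
  moreover have "x \<in> span ?B"
    by (rule span_base) (auto intro: range_eqI[of _ _ "[]"])
  ultimately show "x = 0" by blast
qed

lemma word_replicate: "act_word br f (replicate n i) x = (br (f i) ^^ n) x"
  by (induction n) simp_all

text \<open>It suffices that every \<open>e k\<close> kills the vector. For k = i the coefficient in
  \<open>e0_pow_f0\<close> vanishes. For k = j, \<open>e j\<close> passes all \<open>f i\<close> and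
  leaves \<open>A $ j $ i\<close> times (ad f_i)^c f_i. Any other \<open>e k\<close> commutes with
  \<open>f i\<close> and \<open>f j\<close>.\<close>

lemma serre_relation:
  assumes "i \<noteq> j"
  shows "(br (f i) ^^ Suc (nat (- A $ i $ j))) (f j) = 0"
proof -
  define c where "c = nat (- A $ i $ j)"
  let ?x = "(br (f i) ^^ Suc c) (f j)"
  have le: "A $ i $ j \<le> 0" and sym: "A $ i $ j = 0 \<Longrightarrow> A $ j $ i = 0"
    using gcm assms by (auto simp: generalized_cartan_matrix_def)
  have c: "of_int (- A $ i $ j) = (of_nat c :: complex)"
    using le by (simp add: c_def of_nat_nat)
  have hf: "br (coroot i) (f j) = scl (of_nat c) (f j)"
    using br_cartan_f[OF coroot_in_cartan, of i j] c[symmetric] by (simp add: cartan_matrix)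
  interpret sl: sl2_triple scl br scl br "e i" "coroot i" "f i" "{0}"
    by (rule adj.sl2_triple_simple) (rule adj.submodule_zero)
  have "br (e k) ?x = 0" for k
  proof (cases "k = i")
    case True
    have "br (e i) (f j) = 0" using assms by (simp add: br_e_f)
    then show ?thesis
      using sl.e0_pow_f0[OF hf, of c] True by (simp del: funpow.simps)
  next
    case False
    have comm: "br (e k) ((br (f i) ^^ n) y) = (br (f i) ^^ n) (br (e k) y)" for n y
      using False by (induction n) (simp_all add: adj.act_swap[of "e k" "f i"] br_e_f)
    show ?thesis
    proof (cases "k = j")
      case True
      have "br (f i) (coroot j) = scl (of_int (A $ j $ i)) (f i)"
        using br_cartan_f[OF coroot_in_cartan, of j i] br_swap[of "f i" "coroot j"]
        by (simp add: cartan_matrix)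
      \<comment> \<open>For c > 0 the vector vanishes since [f_i, f_i] = 0; for c = 0 the
        coefficient \<open>A $ j $ i\<close> vanishes together with
        \<open>A $ i $ j\<close>.\<close>
      moreover have "(br (f i) ^^ c) (f i) = 0" if "c \<noteq> 0"
        using that by (cases c) (simp_all add: br_self funpow_swap1)
      moreover have "A $ j $ i = 0" if "c = 0"
        using that le sym by (simp add: c_def)
      ultimately have "(br (f i) ^^ Suc c) (coroot j) = 0"
        by (cases "c = 0") (simp_all add: funpow_swap1 adj.pow_scale)
      then show ?thesis using comm[of "Suc c" "f j"] True by (simp add: br_e_f del: funpow.simps)
    next
      case False
      then show ?thesis using comm[of "Suc c" "f j"] by (simp add: br_e_f del: funpow.simps)
    qed
  qed
  moreover have "root_vec (- word_wt (replicate (Suc c) i @ [j])) ?x"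
    using root_vec_f_word[of "replicate (Suc c) i" j] by (simp only: word_replicate)
  ultimately show ?thesis
    using singular_vector_eq_0[of "replicate (Suc c) i @ [j]" ?x] by (simp add: c_def)
qed

text \<open>The elements on which ad f_i is nilpotent form a Lie subalgebra, so generators are
  enough: two brackets kill \<open>H\<close>, three kill each \<open>e k\<close>, and the Serre
  relation handles the \<open>f k\<close> with k different from i.\<close>

lemma ad_f_nilpotent: "\<exists>n. (br (f i) ^^ n) y = 0"
proof -
  let ?S = "adj.nil_part (f i) {0}"
  have br: "br y z \<in> ?S" if "y \<in> ?S" "z \<in> ?S" for y z
    using that adj.pow_act_in_submodule[OF adj.submodule_zero, of _ "f i" y _ z]
    unfolding adj.nil_part_def by fastforce
  have "lie_subalgebra ?S"
    unfolding lie_subalgebra_def subspace_def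
  proof (intro conjI ballI allI)
    fix x y assume "x \<in> ?S" "y \<in> ?S"
    then obtain m n where mn: "(br (f i) ^^ m) x \<in> {0}" "(br (f i) ^^ n) y \<in> {0}"
      by (auto simp: adj.nil_part_def)
    have "(br (f i) ^^ (max m n)) x \<in> {0}" "(br (f i) ^^ (max m n)) y \<in> {0}"
      using adj.pow_mono_submodule[OF adj.submodule_zero mn(1), of "max m n"]
        adj.pow_mono_submodule[OF adj.submodule_zero mn(2), of "max m n"] by simp_all
    then have "(br (f i) ^^ (max m n)) (x + y) \<in> {0}"
      by (simp add: adj.pow_add)
    then show "x + y \<in> ?S" by (auto simp: adj.nil_part_def)
  qed (use br in \<open>auto simp: adj.nil_part_def adj.pow_scale\<close>)
  moreover have "H \<union> range e \<union> range f \<subseteq> ?S"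
  proof (intro Un_least subsetI; (elim rangeE)?)
    fix h assume h: "h \<in> H"
    have "br (f i) h = scl (\<alpha> i h) (f i)"
      using br_cartan_f[OF h, of i] br_swap[of "f i" h] by simp
    then have "(br (f i) ^^ 2) h \<in> {0}"
      by (simp add: numeral_2_eq_2 br_scale_right br_self)
    then show "h \<in> ?S" unfolding adj.nil_part_def by blast
  next
    fix x k assume x: "x = e k"
    have "br (f i) (e k) = - (if k = i then coroot i else 0)"
      using br_swap[of "f i" "e k"] by (simp add: br_e_f)
    moreover have "br (f i) (coroot i) = scl 2 (f i)"
      using br_cartan_f[OF coroot_in_cartan, of i i] br_swap[of "f i" "coroot i"]
      by (simp add: cartan_matrix)
    ultimately have "(br (f i) ^^ 3) x \<in> {0}"
      by (simp add: x numeral_3_eq_3 br_minus_right br_scale_right br_self)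
    then show "x \<in> ?S" unfolding adj.nil_part_def by blast
  next
    fix x k assume x: "x = f k"
    show "x \<in> ?S"
    proof (cases "k = i")
      case True
      then have "(br (f i) ^^ 1) x \<in> {0}" by (simp add: x br_self)
      then show ?thesis unfolding adj.nil_part_def by blast
    next
      case False
      then have "(br (f i) ^^ Suc (nat (- A $ i $ k))) x \<in> {0}"
        using serre_relation[of i k] by (simp add: x del: funpow.simps)
      then show ?thesis unfolding adj.nil_part_def by blast
    qed
  qed
  ultimately have "?S = UNIV" by (rule generated)
  then have "y \<in> ?S" by simp
  then show ?thesis by (simp add: adj.nil_part_def)
qed

lemma ad_e_nilpotent: "\<exists>n. (br (e i) ^^ n) y = 0"
  using kac_moody_algebra.ad_f_nilpotent[OF kac_moody_algebra_swap] .

text \<open>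
  In \<open>\<gg> \<times> \<gg>\<close> the elements \<open>(e\<^sub>i, f\<^sub>i)\<close>, \<open>(f\<^sub>i, e\<^sub>i)\<close> and \<open>(h, -h)\<close> satisfy the Chevalley relations.
  The subalgebra they generate projects onto both factors and, by the absence of ideals meeting \<open>H\<close>
  trivially, is the graph of an automorphism, the Chevalley involution.
\<close>

lemma f_word_nonzero:
  assumes "act_word br e ks (e k) \<noteq> 0"
  shows "act_word br f ks (f k) \<noteq> 0"
proof
  assume f0: "act_word br f ks (f k) = 0"
  define scl2 :: "complex \<Rightarrow> 'g \<times> 'g \<Rightarrow> 'g \<times> 'g" where "scl2 c x = (scl c (fst x), scl c (snd x))" for c x
  define br2 :: "'g \<times> 'g \<Rightarrow> 'g \<times> 'g \<Rightarrow> 'g \<times> 'g"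
    where "br2 = (\<lambda>x y. (br (fst x) (fst y), br (snd x) (snd y)))"
  define H2 where "H2 = (\<lambda>h. (h, - h)) ` H"
  define e2 where "e2 i = (e i, f i)" for i
  define f2 where "f2 i = (f i, e i)" for i
  have H2I: "(h, - h) \<in> H2" if "h \<in> H" for h
    using that by (auto simp: H2_def)
  interpret P: chevalley_system scl2 br2 H2 "\<lambda>i. (coroot i, - coroot i)" "\<lambda>i h. \<alpha> i (fst h)" e2 f2
  proof unfold_locales
    interpret P: vector_space scl2
      by unfold_locales (simp_all add: scl2_def prod_eq_iff scale_right_distrib scale_left_distrib)
    show "P.subspace H2"
    proof (rule P.subspaceI)
      show "0 \<in> H2"
        using H2I[OF subspace_0[OF subspace_cartan]] by (simp add: zero_prod_def)
      show "x + y \<in> H2" if "x \<in> H2" "y \<in> H2" for x y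
        using that H2I[OF subspace_add[OF subspace_cartan]] by (auto simp: H2_def)
      show "scl2 c x \<in> H2" if "x \<in> H2" for c x
        using that H2I[OF subspace_scale[OF subspace_cartan]] by (auto simp: H2_def scl2_def)
    qed
    show "br2 (e2 i) (f2 j) = (if i = j then (coroot i, - coroot i) else 0)" for i j
      using br_swap[of "f i" "e j"] by (auto simp: br2_def e2_def f2_def br_e_f zero_prod_def)
  qed (auto simp: scl2_def br2_def prod_eq_iff scale_right_distrib scale_left_distrib br_add_left
      br_add_right br_scale_left br_scale_right br_self jacobi H2_def coroot_in_cartan
      br_cartan br_cartan_e br_cartan_f e2_def f2_def br_minus_left br_minus_right)
  define D where "D = P.span (H2 \<union> P.e_words \<union> P.f_words)"
  have D: "P.subspace D" "\<And>x y. x \<in> D \<Longrightarrow> y \<in> D \<Longrightarrow> br2 x y \<in> D"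
    using P.lie_subalgebra_triangular by (auto simp: D_def P.lie_subalgebra_def)
  have gens: "(h, - h) \<in> D" "e2 i \<in> D" "f2 i \<in> D" if "h \<in> H" for h i
    unfolding D_def using H2I[OF that] P.gen_in_words by (auto intro: P.span_base)
  \<comment> \<open>Surjectivity of the first projection makes \<open>K\<close> below an ideal of
    all of g.\<close>
  have onto: "\<exists>z. (y, z) \<in> D" for y
  proof -
    have "lie_subalgebra (fst ` D)"
      unfolding lie_subalgebra_def subspace_def
    proof (intro conjI ballI allI)
      show "0 \<in> fst ` D" using P.subspace_0[OF D(1)] by force
      fix x y assume "x \<in> fst ` D" "y \<in> fst ` D"
      then obtain x' y' where xy: "(x, x') \<in> D" "(y, y') \<in> D" by auto
      show "x + y \<in> fst ` D" using P.subspace_add[OF D(1) xy] by force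
      show "br x y \<in> fst ` D" using D(2)[OF xy] unfolding br2_def by force
    next
      fix c x assume "x \<in> fst ` D"
      then obtain x' where "(x, x') \<in> D" by auto
      then show "scl c x \<in> fst ` D"
        using P.subspace_scale[OF D(1), of "(x, x')" c] unfolding scl2_def by force
    qed
    moreover have "H \<union> range e \<union> range f \<subseteq> fst ` D"
      using gens subspace_0[OF subspace_cartan] unfolding e2_def f2_def by force
    ultimately have "fst ` D = UNIV" by (rule generated)
    then have "y \<in> fst ` D" by simp
    then show ?thesis by auto
  qed
  \<comment> \<open>If \<open>K\<close> is trivial, the second component of a pair in
    \<open>D\<close> determines the first.\<close>
  define K where "K = {x. (x, 0) \<in> D}"
  have "lie_ideal K"
    unfolding lie_ideal_def subspace_def
  proof (intro conjI ballI allI)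
    show "0 \<in> K" using P.subspace_0[OF D(1)] by (simp add: K_def zero_prod_def)
    show "x + y \<in> K" if "x \<in> K" "y \<in> K" for x y
      using P.subspace_add[OF D(1), of "(x, 0)" "(y, 0)"] that by (simp add: K_def)
    show "scl c x \<in> K" if "x \<in> K" for c x
      using P.subspace_scale[OF D(1), of "(x, 0)" c] that by (simp add: K_def scl2_def)
    show "br y x \<in> K" if x: "x \<in> K" for y x
    proof -
      obtain z where "(y, z) \<in> D" using onto by blast
      then show ?thesis using D(2)[of "(y, z)" "(x, 0)"] x by (simp add: K_def br2_def)
    qed
  qed
  moreover have "h = 0" if h: "h \<in> K" "h \<in> H" for h
  proof (rule ccontr)
    assume "h \<noteq> 0"
    interpret Padj: chevalley_module scl2 br2 H2 "\<lambda>i. (coroot i, - coroot i)" "\<lambda>i h. \<alpha> i (fst h)" e2 f2 scl2 br2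
      by (rule P.chevalley_module_adjoint)
    \<comment> \<open>A nonzero (h, 0) is outside \<open>H2\<close> but has weight zero. Some word
      would then be a nonzero vector of weight zero, whereas the weight of a nonempty word is never
      zero.\<close>
    have "(h, 0) \<notin> H2" using \<open>h \<noteq> 0\<close> by (auto simp: H2_def)
    moreover have "(h, 0) \<in> P.span (H2 \<union> P.e_words \<union> P.f_words)"
      using h(1) by (simp add: K_def D_def)
    moreover have "Padj.wt_vec (\<lambda>_. 0) 0 (h, 0)"
      unfolding Padj.wt_vec_def
      using h(2) br_cartan by (auto simp: br2_def scl2_def H2_def zero_prod_def)
    moreover have "\<exists>m. Padj.wt_vec (\<lambda>_. 0) m b" if "b \<in> H2 \<union> P.e_words \<union> P.f_words" for b
      using that P.root_vec_cartan P.root_vec_e_word P.root_vec_f_word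
      unfolding P.wt_vec_adjoint P.e_words_def P.f_words_def by blast
    ultimately obtain b where b: "b \<in> H2 \<union> P.e_words \<union> P.f_words"
      "Padj.wt_vec (\<lambda>_. 0) 0 b" "b \<notin> H2"
      using P.cartan_subspace
      by (elim Padj.wt_vec_span_elem[where x = "(h, 0)" and N = H2]) blast+
    note b = b(1) b(2)[unfolded P.wt_vec_adjoint] b(3)
    have "b \<noteq> 0" using b(3) P.subspace_0[OF P.cartan_subspace] by auto
    have rt2: "P.rt n (h, h') = rt n h" for n h h'
      by (simp add: P.rt_def rt_def)
    have word_wt: "n = 0" if n: "P.root_vec n b" for n
    proof (rule rt_eq_0D)
      fix h assume "h \<in> H"
      then have "scl2 (P.rt n (h, - h)) b = scl2 (P.rt 0 (h, - h)) b"
        using n b(2) H2I[OF \<open>h \<in> H\<close>] by (auto simp: P.root_vec_def)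
      then show "rt n h = 0" using \<open>b \<noteq> 0\<close> by (simp add: rt2)
    qed
    consider ks k where "b = act_word br2 e2 ks (e2 k)" | ks k where "b = act_word br2 f2 ks (f2 k)"
      using b(1,3) unfolding P.e_words_def P.f_words_def by blast
    then show False
    proof cases
      case (1 ks k)
      then show ?thesis
        using word_wt[of "word_wt (ks @ [k])"] P.root_vec_e_word by (simp add: word_wt_eq_0_iff)
    next
      case (2 ks k)
      then show ?thesis
        using word_wt[of "- word_wt (ks @ [k])"] P.root_vec_f_word by (simp add: word_wt_eq_0_iff)
    qed
  qed
  ultimately have "K = {0}"
    using no_ideals[of K] subspace_0[OF subspace_cartan] unfolding lie_ideal_def subspace_def
    by blast
  moreover have "act_word br2 e2 ks (e2 k) \<in> D"
    unfolding D_def P.e_words_def by (intro P.span_base) blast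
  then have "act_word br e ks (e k) \<in> K"
    using f0 unfolding K_def br2_def e2_def act_word_prod by simp
  ultimately show False using assms by simp
qed

lemma e_word_nonzero:
  assumes "act_word br f ks (f k) \<noteq> 0"
  shows "act_word br e ks (e k) \<noteq> 0"
  using kac_moody_algebra.f_word_nonzero[OF kac_moody_algebra_swap assms] .

text \<open>The roots in coordinates; \<open>roots_eq\<close> shows that no element of
  \<open>roots\<close> is missed.\<close>

definition root_set :: "(int^'i) set" where
  "root_set = {n. n \<noteq> 0 \<and> (\<exists>x. x \<noteq> 0 \<and> root_vec n x)}"

text \<open>By the triangular decomposition a root vector of weight \<open>n\<close> yields a
  spanning element of weight \<open>n\<close>, which is not in \<open>H\<close> because
  \<open>n\<close> is nonzero.\<close>

lemma root_set_cases:
  assumes "n \<in> root_set"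
  obtains ks k where "n = word_wt (ks @ [k])" "act_word br e ks (e k) \<noteq> 0"
  | ks k where "n = - word_wt (ks @ [k])" "act_word br f ks (f k) \<noteq> 0"
proof -
  obtain x where x: "x \<noteq> 0" "root_vec n x" "n \<noteq> 0"
    using assms by (auto simp: root_set_def)
  have "x \<in> span (H \<union> e_words \<union> f_words)" by (simp add: span_triangular)
  moreover have "\<exists>m. adj.wt_vec (\<lambda>_. 0) m b" if "b \<in> H \<union> e_words \<union> f_words" for b
    using that root_vec_cartan root_vec_e_word root_vec_f_word
    unfolding wt_vec_adjoint e_words_def f_words_def by blast
  ultimately obtain b where b: "b \<in> H \<union> e_words \<union> f_words" "root_vec n b" "b \<noteq> 0"
    using adj.wt_vec_span_elem[of x "H \<union> e_words \<union> f_words" "\<lambda>_. 0" n "{0}"] x subspace_single_0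
    unfolding wt_vec_adjoint by (metis singleton_iff)
  have uniq: "m = n" if "root_vec m b" for m
    using adj.wt_vec_unique[of "\<lambda>_. 0" m b n] b(2,3) that by (simp add: wt_vec_adjoint)
  consider "b \<in> H" | "b \<in> e_words" | "b \<in> f_words" using b(1) by blast
  then show ?thesis
  proof cases
    case 1
    then show ?thesis using uniq[of 0] root_vec_cartan x(3) by blast
  next
    case 2
    then obtain ks k where "b = act_word br e ks (e k)" by (auto simp: e_words_def)
    then show ?thesis using that(1) uniq root_vec_e_word b(3) by blast
  next
    case 3
    then obtain ks k where "b = act_word br f ks (f k)" by (auto simp: f_words_def)
    then show ?thesis using that(2) uniq root_vec_f_word b(3) by blast
  qed
qed

lemma word_wt_snoc_nonzero: "word_wt (ks @ [k]) \<noteq> 0"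
  by (simp add: word_wt_eq_0_iff)

text \<open>Words in the \<open>e i\<close> and in the \<open>f i\<close> with the same indices
  vanish together.\<close>

lemma root_set_uminus:
  assumes "n \<in> root_set"
  shows "- n \<in> root_set"
  using assms
proof (cases rule: root_set_cases)
  case (1 ks k)
  then show ?thesis
    using f_word_nonzero[of ks k] root_vec_f_word[of ks k] word_wt_snoc_nonzero[of ks k]
    unfolding root_set_def by auto
next
  case (2 ks k)
  then show ?thesis
    using e_word_nonzero[of ks k] root_vec_e_word[of ks k] word_wt_snoc_nonzero[of ks k]
    unfolding root_set_def by auto
qed

lemma root_set_sign:
  assumes "n \<in> root_set"
  shows "(\<forall>i. n $ i \<ge> 0) \<or> (\<forall>i. n $ i \<le> 0)"
  using assms by (cases rule: root_set_cases) (simp_all add: word_wt_nonneg)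

end

section \<open>Roots of height one\<close>

definition ht_off :: "'i set \<Rightarrow> int^'i::finite \<Rightarrow> int" where
  "ht_off J n = (\<Sum>i\<in>- J. n $ i)"

lemma ht_off_simps [simp]:
  "ht_off J 0 = 0" "ht_off J (m + n) = ht_off J m + ht_off J n"
  "ht_off J (m - n) = ht_off J m - ht_off J n" "ht_off J (- n) = - ht_off J n"
  "ht_off J (axis i c) = (if i \<in> J then 0 else c)"
  by (simp_all add: ht_off_def sum.distrib sum_subtractf sum_negf axis_def sum.delta)

lemma ht_off_sum_list: "ht_off J (sum_list bs) = (\<Sum>b\<leftarrow>bs. ht_off J b)"
  by (induction bs) simp_all

lemma ht_off_word_wt: "set ks \<subseteq> J \<Longrightarrow> ht_off J (word_wt ks) = 0"
  by (induction ks) auto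

context kac_moody_algebra
begin

definition roots1 :: "'i set \<Rightarrow> (int^'i) set" where
  "roots1 J = {b \<in> root_set. ht_off J b = 1}"

lemma roots1_nonneg:
  assumes "b \<in> roots1 J"
  shows "b $ i \<ge> 0"
proof (rule ccontr)
  assume "\<not> b $ i \<ge> 0"
  then have "\<forall>i. b $ i \<le> 0"
    using root_set_sign[of b] assms by (auto simp: roots1_def)
  then have "ht_off J b \<le> 0"
    unfolding ht_off_def by (simp add: sum_nonpos)
  then show False using assms by (simp add: roots1_def)
qed

text \<open>Brackets (ad f_j1) ... (ad f_jr) f_i with i outside \<open>J\<close> and all j in
  \<open>J\<close>. The second argument records the negated weight, which stays meaningful when the
  bracket vanishes.\<close>

inductive ht1_word :: "'i set \<Rightarrow> 'g \<Rightarrow> int^'i \<Rightarrow> bool" for J where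
  gen: "i \<notin> J \<Longrightarrow> ht1_word J (f i) (axis i 1)"
| step: "ht1_word J x b \<Longrightarrow> j \<in> J \<Longrightarrow> ht1_word J (br (f j) x) (b + axis j 1)"

interpretation adj: km_module scl br A H coroot \<alpha> e f scl br
  by (rule km_module_adjoint)

lemma ht1_word_props:
  assumes "ht1_word J x b"
  shows "root_vec (- b) x" "ht_off J b = 1"
proof -
  show "root_vec (- b) x"
    using assms
  proof induction
    case (gen i)
    show ?case by (rule root_vec_f)
  next
    case (step x b j)
    then show ?case
      using adj.wt_vec_f[of "\<lambda>_. 0" "- b" x j] by (simp add: wt_vec_adjoint)
  qed
  show "ht_off J b = 1" using assms by induction simp_all
qed

lemma ht1_word_root:
  assumes "ht1_word J x b" "x \<noteq> 0"
  shows "b \<in> roots1 J"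
proof -
  have "- b \<noteq> 0" using ht1_word_props(2)[OF assms(1)] by auto
  then have "- b \<in> root_set"
    using ht1_word_props(1)[OF assms(1)] assms(2) unfolding root_set_def by blast
  then show ?thesis
    using root_set_uminus[of "- b"] ht1_word_props(2)[OF assms(1)] by (simp add: roots1_def)
qed

end

section \<open>Products of height one words acting on a module\<close>

context km_module
begin

text \<open>\<open>B\<close> describes the admissible right-hand ends: in V, words in the
  \<open>f j\<close> with j in \<open>J\<close> applied to the highest weight vector; in the adjoint
  module, height one words themselves.\<close>

inductive ht1_product :: "'i set \<Rightarrow> ('v \<Rightarrow> int^'i \<Rightarrow> bool) \<Rightarrow> 'v \<Rightarrow> int^'i \<Rightarrow> bool" for J B where
  base: "B z n \<Longrightarrow> ht1_product J B z n"
| step: "ht1_word J x b \<Longrightarrow> ht1_product J B z n \<Longrightarrow> ht1_product J B (act x z) (n + b)"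

text \<open>For l outside \<open>J\<close>, \<open>f l\<close> is a height one word and becomes a
  new factor. For l in \<open>J\<close> it moves to the right: its bracket with a factor is again a
  height one word, and the end absorbs it by the assumption on \<open>B\<close>.\<close>

lemma span_ht1_product_stable:
  assumes B: "\<And>z n j. B z n \<Longrightarrow> j \<in> J \<Longrightarrow> B (act (f j) z) (n + axis j 1)"
    and u: "u \<in> M.span {z. \<exists>n. ht1_product J B z n}"
  shows "act (f l) u \<in> M.span {z. \<exists>n. ht1_product J B z n}"
proof (rule act_span[OF _ u])
  let ?U = "M.span {z. \<exists>n. ht1_product J B z n}"
  have word: "act x u \<in> ?U" if x: "ht1_word J x b" and u: "u \<in> ?U" for x b u
    by (rule act_span[OF _ u]) (use ht1_product.step[OF x] in \<open>blast intro: M.span_base\<close>)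
  fix z assume "z \<in> {z. \<exists>n. ht1_product J B z n}"
  then obtain n where z: "ht1_product J B z n" by blast
  show "act (f l) z \<in> ?U"
  proof (cases "l \<in> J")
    case False
    then show ?thesis
      using word[OF ht1_word.gen] z by (blast intro: M.span_base)
  next
    case True
    show ?thesis
      using z
    proof induction
      case (base z n)
      then show ?case
        using B[OF base True] ht1_product.base[of B] by (blast intro: M.span_base)
    next
      case (step x b z n)
      have "act (br (f l) x) z \<in> ?U"
        using word[OF ht1_word.step[OF step.hyps(1) True]] step.hyps(2) by (blast intro: M.span_base)
      then show ?case
        using word[OF step.hyps(1) step.IH] by (simp add: act_swap[of "f l" x] M.span_add)
    qed
  qed
qed

lemma wt_vec_ht1_product:
  assumes "ht1_product J B z n" "\<And>z n. B z n \<Longrightarrow> wt_vec lam (- n) z"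
  shows "wt_vec lam (- n) z"
  using assms(1)
proof induction
  case (step x b z n)
  then show ?case
    using wt_vec_act[OF ht1_word_props(1)[OF step.hyps(1)] step.IH] by (simp add: algebra_simps)
qed (rule assms(2))

text \<open>A nonzero product has only nonzero factors, so each factor contributes a genuine
  root.\<close>

lemma ht1_product_weight:
  assumes "ht1_product J B z n" "z \<noteq> 0"
  shows "\<exists>u m bs. B u m \<and> u \<noteq> 0 \<and> set bs \<subseteq> roots1 J \<and> n = m + sum_list bs"
  using assms
proof induction
  case (base z n)
  then show ?case by (intro exI[of _ z] exI[of _ n] exI[of _ "[]"]) simp
next
  case (step x b z n)
  have "x \<noteq> 0" "z \<noteq> 0" using step.prems by auto
  then obtain u m bs where "B u m" "u \<noteq> 0" "set bs \<subseteq> roots1 J" "n = m + sum_list bs"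
    using step.IH by blast
  moreover have "b \<in> roots1 J"
    using ht1_word_root step.hyps(1) \<open>x \<noteq> 0\<close> by blast
  ultimately show ?case
    by (intro exI[of _ u] exI[of _ m] exI[of _ "b # bs"]) (simp add: add_ac)
qed

text \<open>As \<open>c\<close> is the value of the weight at the co-root,
  \<open>n - axis j c\<close> is its simple reflection. Depending on the sign of \<open>c\<close>,
  injectivity of f^c or of e^(-c) in V/N provides the vector.\<close>

lemma reflect_weight:
  assumes N: "submodule N" and x: "x \<notin> N" "wt_vec lam n x"
    and f: "(act (f j) ^^ k) x \<in> N" and e: "\<And>y. \<exists>k. (act (e j) ^^ k) y \<in> N"
  obtains c y where "lam (coroot j) + of_int (pairing j n) = of_int c"
    "y \<notin> N" "wt_vec lam (n - axis j c) y"
proof -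
  interpret sl: sl2_triple scl br smul act "e j" "coroot j" "f j" N
    by (rule sl2_triple_simple[OF N])
  have h: "act (coroot j) x = smul (lam (coroot j) + of_int (pairing j n)) x"
    using x(2) coroot_in_cartan[of j] by (simp add: wt_vec_def rt_coroot)
  then have "lam (coroot j) + of_int (pairing j n) \<in> \<int>"
    using sl.nilpotent_weight_int f x(1) e by blast
  then obtain c where c: "lam (coroot j) + of_int (pairing j n) = of_int c"
    by (rule Ints_cases)
  show ?thesis
  proof (cases "c \<ge> 0")
    case True
    obtain k where "(act (e j) ^^ k) x \<in> N" using e by blast
    then have "(act (f j) ^^ nat c) x \<notin> N"
      using sl.pow_f0_injective[of x "nat c"] h c x(1) True by (auto simp: of_nat_nat)
    then show ?thesis
      using that[OF c] wt_vec_pow_f[OF x(2), of j "nat c"] True by simp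
  next
    case False
    then have "(act (e j) ^^ nat (- c)) x \<notin> N"
      using sl.pow_e0_injective[of x "nat (- c)" k] h c x(1) f by (auto simp: of_nat_nat)
    moreover have "n + axis j (- c) = n - axis j c"
      by (simp add: vec_eq_iff axis_def)
    ultimately show ?thesis
      using that[OF c] wt_vec_pow_e[OF x(2), of j "nat (- c)"] False by simp
  qed
qed

end

section \<open>Roots as sums of roots of height one\<close>

context kac_moody_algebra
begin

interpretation adj: km_module scl br A H coroot \<alpha> e f scl br
  by (rule km_module_adjoint)

text \<open>\<open>reflect_weight\<close> in the adjoint module, where ad e_j and ad f_j are locally
  nilpotent; for j in \<open>J\<close> the reflection changes no coefficient off
  \<open>J\<close>.\<close>

lemma roots1_reflect:
  assumes "b \<in> roots1 J" "j \<in> J"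
  shows "b - axis j (pairing j b) \<in> roots1 J"
proof -
  obtain x where x: "x \<noteq> 0" "root_vec b x"
    using assms(1) by (auto simp: roots1_def root_set_def)
  obtain k where "(br (f j) ^^ k) x = 0" using ad_f_nilpotent by blast
  then obtain c y where y: "(0::complex) + of_int (pairing j b) = of_int c" "y \<notin> {0}"
    "adj.wt_vec (\<lambda>_. 0) (b - axis j c) y"
    using adj.reflect_weight[where N = "{0}" and x = x and lam = "\<lambda>_. 0" and n = b and j = j and k = k] x ad_e_nilpotent[of j] adj.submodule_zero
    by (auto simp: wt_vec_adjoint)
  have "ht_off J (b - axis j (pairing j b)) = 1"
    using assms by (simp add: roots1_def)
  moreover from this have "b - axis j (pairing j b) \<noteq> 0"
    by (metis ht_off_simps(1) zero_neq_one)
  ultimately show ?thesis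
    using y unfolding roots1_def root_set_def by (auto simp: wt_vec_adjoint)
qed

definition J_words :: "'i set \<Rightarrow> 'g set" where
  "J_words J = {act_word br f ks (f k) | ks k. set ks \<subseteq> J \<and> k \<in> J}"

text \<open>Bracketing with \<open>f j\<close>, j in \<open>J\<close>, preserves the span of height
  one words; by \<open>br_leibniz\<close> so does bracketing with an iterated bracket of such
  elements.\<close>

lemma br_J_word_span:
  assumes "set ks \<subseteq> J" "k \<in> J" "x \<in> span {x. \<exists>b. ht1_word J x b}"
  shows "br (act_word br f ks (f k)) x \<in> span {x. \<exists>b. ht1_word J x b}"
  using assms
proof (induction ks arbitrary: x)
  case Nil
  have "br (f k) b \<in> span {x. \<exists>b. ht1_word J x b}" if "b \<in> {x. \<exists>b. ht1_word J x b}" for b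
    using that ht1_word.step[OF _ Nil.prems(2)] by (blast intro: span_base)
  then show ?case using adj.act_span[OF _ Nil.prems(3)] by simp
next
  case (Cons j ks)
  have f: "br (f j) y \<in> span {x. \<exists>b. ht1_word J x b}" if y: "y \<in> span {x. \<exists>b. ht1_word J x b}" for y
  proof (rule adj.act_span[OF _ y])
    have j: "j \<in> J" using Cons.prems(1) by simp
    fix b assume "b \<in> {x. \<exists>b. ht1_word J x b}"
    then show "br (f j) b \<in> span {x. \<exists>b. ht1_word J x b}"
      using ht1_word.step[OF _ j] by (blast intro: span_base)
  qed
  show ?case
    using Cons f by (simp add: br_leibniz span_diff)
qed

text \<open>The adjoint counterpart of the spanning argument for V. The words in
  \<open>J_words\<close> have height zero off \<open>J\<close> and have to be kept as separate
  spanning elements.\<close>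

lemma f_word_in_span:
  "act_word br f ks (f k) \<in> span (J_words J \<union> {z. \<exists>n. adj.ht1_product J (ht1_word J) z n})"
proof (induction ks)
  case Nil
  have "f k \<in> J_words J \<union> {z. \<exists>n. adj.ht1_product J (ht1_word J) z n}"
  proof (cases "k \<in> J")
    case True
    then have "act_word br f [] (f k) \<in> J_words J"
      unfolding J_words_def by fastforce
    then show ?thesis by simp
  next
    case False
    then show ?thesis
      using adj.ht1_product.base[of "ht1_word J", OF ht1_word.gen] by blast
  qed
  then show ?case by (simp add: span_base)
next
  case (Cons l ks)
  let ?P = "{z. \<exists>n. adj.ht1_product J (ht1_word J) z n}"
  have "br (f l) b \<in> span (J_words J \<union> ?P)" if "b \<in> J_words J \<union> ?P" for b
    using that
  proof
    assume "b \<in> ?P"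
    then have "b \<in> span ?P" by (rule span_base)
    then have "br (f l) b \<in> span ?P"
      using adj.span_ht1_product_stable[of "ht1_word J" J b l] ht1_word.step by blast
    then show ?thesis using span_mono[of ?P "J_words J \<union> ?P"] by blast
  next
    assume "b \<in> J_words J"
    then obtain ls k where b: "b = act_word br f ls (f k)" "set ls \<subseteq> J" "k \<in> J"
      unfolding J_words_def by blast
    show ?thesis
    proof (cases "l \<in> J")
      case True
      then have "act_word br f (l # ls) (f k) \<in> J_words J"
        using b unfolding J_words_def by fastforce
      then show ?thesis using b by (simp add: span_base)
    next
      case False
      \<comment> \<open>The bracket of \<open>f l\<close> with \<open>b\<close> is read backwards,
        as \<open>b\<close> acting on the height one word \<open>f l\<close>.\<close>
      have "f l \<in> span {x. \<exists>b. ht1_word J x b}"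
        using ht1_word.gen[OF False] by (blast intro: span_base)
      then have "br b (f l) \<in> span {x. \<exists>b. ht1_word J x b}"
        unfolding b(1) by (rule br_J_word_span[OF b(2,3)])
      moreover have "{x. \<exists>b. ht1_word J x b} \<subseteq> J_words J \<union> ?P"
        using adj.ht1_product.base by blast
      ultimately have "br b (f l) \<in> span (J_words J \<union> ?P)"
        using span_mono by blast
      then show ?thesis using br_swap[of "f l" b] by (simp add: span_neg)
    qed
  qed
  then show ?case using adj.act_span[OF _ Cons.IH] by simp
qed

text \<open>Since \<open>- b\<close> is a root, some nonzero f-word has weight \<open>- b\<close>.
  It expands into \<open>J_words\<close> and products; the former have height zero, so comparing
  weights leaves a nonzero product.\<close>

lemma root_ht1_product:
  assumes "b \<in> root_set" "\<And>i. b $ i \<ge> 0" "ht_off J b \<noteq> 0"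
  obtains z where "adj.ht1_product J (ht1_word J) z b" "z \<noteq> 0"
proof -
  let ?P = "{z. \<exists>n. adj.ht1_product J (ht1_word J) z n}"
  have wtP: "adj.wt_vec (\<lambda>_. 0) (- n) z" if "adj.ht1_product J (ht1_word J) z n" for z n
    using adj.wt_vec_ht1_product[OF that, of "\<lambda>_. 0"] ht1_word_props(1) by (simp add: wt_vec_adjoint)
  have wtJ: "\<exists>n. adj.wt_vec (\<lambda>_. 0) (- n) z \<and> ht_off J n = 0" if z: "z \<in> J_words J" for z
  proof -
    obtain ks k where "z = act_word br f ks (f k)" "set (ks @ [k]) \<subseteq> J"
      using z unfolding J_words_def by auto
    then show ?thesis using wt_vec_f_word ht_off_word_wt by blast
  qed
  have "- b \<in> root_set" using root_set_uminus assms(1) .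
  then obtain ks k where ks: "- b = - word_wt (ks @ [k])" "act_word br f ks (f k) \<noteq> 0"
  proof (cases rule: root_set_cases)
    case (1 ks k)
    have "b $ i = 0" for i
      using assms(2)[of i] word_wt_nonneg[of "ks @ [k]" i] unfolding 1(1)[symmetric] by simp
    then show ?thesis using assms(3) by (simp add: ht_off_def)
  qed blast
  have "adj.wt_vec (\<lambda>_. 0) (- b) (act_word br f ks (f k))"
    unfolding ks(1) by (rule wt_vec_f_word)
  moreover have "\<exists>m. adj.wt_vec (\<lambda>_. 0) m z" if "z \<in> J_words J \<union> ?P" for z
    using that wtP wtJ by blast
  ultimately obtain z where z: "z \<in> J_words J \<union> ?P" "adj.wt_vec (\<lambda>_. 0) (- b) z" "z \<notin> {0}"
    using adj.wt_vec_span_elem[OF f_word_in_span[of ks k J], of "\<lambda>_. 0" "- b" "{0}"]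
      ks(2) subspace_single_0 by blast
  have uniq: "n = b" if "adj.wt_vec (\<lambda>_. 0) (- n) z" for n
    using adj.wt_vec_unique[OF that z(2)] z(3) by simp
  have "z \<notin> J_words J"
    using wtJ uniq assms(3) by blast
  then obtain n where "adj.ht1_product J (ht1_word J) z n" using z(1) by blast
  then show ?thesis using that uniq[OF wtP] z(3) by auto
qed

lemma root_sum_roots1:
  assumes "b \<in> root_set" "\<And>i. b $ i \<ge> 0" "ht_off J b \<noteq> 0"
  obtains bs where "set bs \<subseteq> roots1 J" "b = sum_list bs"
proof -
  obtain z where z: "adj.ht1_product J (ht1_word J) z b" "z \<noteq> 0"
    using root_ht1_product[OF assms] .
  obtain u m bs where "ht1_word J u m" "u \<noteq> 0" "set bs \<subseteq> roots1 J" "b = m + sum_list bs"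
    using adj.ht1_product_weight[OF z] by blast
  then show ?thesis
    using that[of "m # bs"] ht1_word_root by auto
qed

text \<open>Height one allows a single factor, so \<open>b\<close> is carried by one nonzero height
  one word; its outermost bracket decides between the two alternatives.\<close>

lemma roots1_cases:
  assumes "b \<in> roots1 J"
  obtains i where "i \<notin> J" "b = axis i 1" | j where "j \<in> J" "b - axis j 1 \<in> roots1 J"
proof -
  have b: "b \<in> root_set" "ht_off J b = 1" using assms by (auto simp: roots1_def)
  then obtain z where z: "adj.ht1_product J (ht1_word J) z b" "z \<noteq> 0"
    using root_ht1_product[of b J] roots1_nonneg[OF assms] by auto
  from z(1) have "ht1_word J z b"
  proof cases
    \<comment> \<open>The end of the product is already a height one word, so one further factor
      brings the height to at least 2.\<close>
    case (step x b' z' n)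
    have "z' \<noteq> 0" using step(1) z(2) by auto
    then obtain u m bs where m: "ht1_word J u m" "set bs \<subseteq> roots1 J" "n = m + sum_list bs"
      using adj.ht1_product_weight[OF step(4)] by blast
    have "(\<Sum>b\<leftarrow>bs. ht_off J b) \<ge> 0"
      using m(2) by (intro sum_list_nonneg) (auto simp: roots1_def)
    then have "ht_off J b \<ge> 2"
      using ht1_word_props(2)[OF m(1)] ht1_word_props(2)[OF step(3)]
      by (simp add: step(2) m(3) ht_off_sum_list)
    then show ?thesis using b(2) by simp
  qed
  then show ?thesis
  proof cases
    case (gen i)
    then show ?thesis using that(1) by blast
  next
    case (step x b' j)
    have "x \<noteq> 0" using step(1) z(2) by auto
    then show ?thesis using that(2)[OF step(4)] ht1_word_root[OF step(3)] step(2) by simp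
  qed
qed

end

section \<open>Weights of highest weight modules\<close>

locale hw_module = km_module scl br A H coroot \<alpha> e f smul act
  for scl :: "complex \<Rightarrow> 'g::ab_group_add \<Rightarrow> 'g" and br
    and A :: "int^'i^'i" and H :: "'g set" and coroot :: "'i \<Rightarrow> 'g" and \<alpha> e f
    and smul :: "complex \<Rightarrow> 'v::ab_group_add \<Rightarrow> 'v" and act +
  fixes lam :: "'g \<Rightarrow> complex" and v :: 'v
  assumes v_nonzero: "v \<noteq> 0"
    and v_weight: "h \<in> H \<Longrightarrow> act h v = smul (lam h) v"
    and v_singular: "act (e i) v = 0"
    and v_generates: "submodule U \<Longrightarrow> v \<in> U \<Longrightarrow> U = UNIV"
begin

lemma wt_vec_v: "wt_vec lam 0 v"
  by (simp add: wt_vec_def v_weight)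

lemma span_words: "M.span (range (\<lambda>ks. act_word act f ks v)) = UNIV"
proof (rule v_generates)
  show "submodule (M.span (range (\<lambda>ks. act_word act f ks v)))"
    by (rule submodule_span_word_f[OF wt_vec_v v_singular])
  show "v \<in> M.span (range (\<lambda>ks. act_word act f ks v))"
    by (rule M.span_base) (auto intro: range_eqI[of _ _ "[]"])
qed

lemma e_nilpotent:
  assumes "submodule N"
  shows "\<exists>k. (act (e i) ^^ k) x \<in> N"
proof -
  have "nil_part (e i) N = UNIV"
  proof (rule v_generates)
    show "submodule (nil_part (e i) N)"
      using submodule_nil_part assms ad_e_nilpotent by blast
    have "(act (e i) ^^ 1) v \<in> N"
      using submoduleD(1)[OF assms] by (simp add: v_singular)
    then show "v \<in> nil_part (e i) N" unfolding nil_part_def by blast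
  qed
  then have "x \<in> nil_part (e i) N" by simp
  then show ?thesis by (simp add: nil_part_def)
qed

text \<open>\<open>wts N\<close> is the set of all \<open>n\<close> such that \<open>\<lambda> - n\<close> is a weight of \<open>V/N\<close>.\<close>

definition wts :: "'v set \<Rightarrow> (int^'i) set" where
  "wts N = {n. \<exists>x. x \<notin> N \<and> wt_vec lam (- n) x}"

lemma wt_word:
  assumes "submodule N" "x \<notin> N" "wt_vec lam (- n) x"
  obtains ks where "n = word_wt ks" "act_word act f ks v \<notin> N"
proof -
  have wt: "wt_vec lam (- word_wt ks) (act_word act f ks v)" for ks
    using wt_vec_word_f[OF wt_vec_v, of ks] by simp
  obtain b where b: "b \<in> range (\<lambda>ks. act_word act f ks v)" "wt_vec lam (- n) b" "b \<notin> N"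
  proof (rule wt_vec_span_elem[OF _ assms(3) _ _ assms(2)])
    show "x \<in> M.span (range (\<lambda>ks. act_word act f ks v))" by (simp add: span_words)
    show "\<exists>m. wt_vec lam m b" if "b \<in> range (\<lambda>ks. act_word act f ks v)" for b
      using that wt by blast
    show "M.subspace N" using assms(1) by (simp add: submodule_def)
  qed
  then obtain ks where ks: "b = act_word act f ks v" by blast
  have "b \<noteq> 0" using b(3) submoduleD(1)[OF assms(1)] by blast
  then have "- word_wt ks = - n"
    using wt_vec_unique[OF wt[of ks]] b(2) ks by simp
  then show ?thesis using that[of ks] b(3) ks by simp
qed

text \<open>Only the empty word applied to \<open>v\<close> has weight \<open>lam\<close>.\<close>

lemma wt_vec_lam:
  assumes "wt_vec lam 0 x"
  obtains c where "x = smul c v"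
proof -
  have wt: "wt_vec lam (- word_wt ks) (act_word act f ks v)" for ks
    using wt_vec_word_f[OF wt_vec_v, of ks] by simp
  have "x \<in> M.span {v}"
  proof (rule ccontr)
    assume x: "x \<notin> M.span {v}"
    obtain b where b: "b \<in> range (\<lambda>ks. act_word act f ks v)" "wt_vec lam 0 b" "b \<notin> M.span {v}"
    proof (rule wt_vec_span_elem[OF _ assms _ M.subspace_span x])
      show "x \<in> M.span (range (\<lambda>ks. act_word act f ks v))" by (simp add: span_words)
      show "\<exists>m. wt_vec lam m b" if "b \<in> range (\<lambda>ks. act_word act f ks v)" for b
        using that wt by blast
    qed
    then obtain ks where ks: "b = act_word act f ks v" by blast
    have "b \<noteq> 0" using b(3) M.span_zero by blast
    then have "- word_wt ks = 0"
      using wt_vec_unique[OF wt[of ks]] b(2) ks by simp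
    then have "b = v" by (simp add: ks word_wt_eq_0_iff)
    then show False using b(3) by (simp add: M.span_base)
  qed
  then show ?thesis using that by (auto simp: M.span_singleton)
qed

lemma wts_nonneg:
  assumes "submodule N" "n \<in> wts N"
  shows "n $ i \<ge> 0"
  using assms wt_word word_wt_nonneg unfolding wts_def by blast

text \<open>Zorn's lemma. In V/L every nonzero submodule contains the image of \<open>w\<close>, so
  nilpotency of \<open>f i\<close> on any nonzero vector transfers to \<open>w\<close>.\<close>

lemma maximal_submodule:
  assumes "submodule N" "w \<notin> N"
  obtains L where "submodule L" "N \<subseteq> L" "w \<notin> L" "\<And>L'. submodule L' \<Longrightarrow> L \<subset> L' \<Longrightarrow> w \<in> L'"
proof -
  define \<A> where "\<A> = {L. submodule L \<and> N \<subseteq> L \<and> w \<notin> L}"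
  have "\<exists>L\<in>\<A>. \<forall>X\<in>\<A>. L \<subseteq> X \<longrightarrow> X = L"
  proof (rule subset_Zorn_nonempty)
    show "\<A> \<noteq> {}" using assms by (auto simp: \<A>_def)
    fix \<C> assume \<C>: "\<C> \<noteq> {}" "subset.chain \<A> \<C>"
    then have sub: "submodule L" "N \<subseteq> L" "w \<notin> L" if "L \<in> \<C>" for L
      using that by (auto simp: subset_chain_def \<A>_def)
    have "submodule (\<Union>\<C>)"
      unfolding submodule_def M.subspace_def
    proof (intro conjI ballI allI)
      show "0 \<in> \<Union>\<C>" using \<C>(1) submoduleD(1)[OF sub(1)] by blast
      fix x y assume "x \<in> \<Union>\<C>" "y \<in> \<Union>\<C>"
      then obtain L L' where L: "x \<in> L" "L \<in> \<C>" "y \<in> L'" "L' \<in> \<C>" by blast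
      then have "L \<subseteq> L' \<or> L' \<subseteq> L"
        using \<C>(2) by (auto simp: subset_chain_def)
      then show "x + y \<in> \<Union>\<C>"
        using L submoduleD(2)[OF sub(1)] by blast
    next
      fix c x assume "x \<in> \<Union>\<C>"
      then show "smul c x \<in> \<Union>\<C>" using submoduleD(4)[OF sub(1)] by blast
    next
      fix a x assume "x \<in> \<Union>\<C>"
      then show "act a x \<in> \<Union>\<C>" using submoduleD(5)[OF sub(1)] by blast
    qed
    then show "\<Union>\<C> \<in> \<A>" using sub \<C>(1) unfolding \<A>_def by blast
  qed
  then obtain L where L: "L \<in> \<A>" "\<And>X. X \<in> \<A> \<Longrightarrow> L \<subseteq> X \<Longrightarrow> X = L" by blast
  show ?thesis
  proof (rule that)
    show "submodule L" "N \<subseteq> L" "w \<notin> L" using L(1) by (auto simp: \<A>_def)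
    show "w \<in> L'" if "submodule L'" "L \<subset> L'" for L'
      using L(2)[of L'] that \<open>N \<subseteq> L\<close> by (auto simp: \<A>_def)
  qed
qed

text \<open>The right-hand side of the weight formula for V/N, in coordinates: \<open>g\<close>
  stands for the functional lam - g.\<close>

definition cone :: "'i set \<Rightarrow> 'v set \<Rightarrow> (int^'i) set" where
  "cone J N = {n + sum_list bs | n bs. n \<in> wts N \<and> (\<forall>i. i \<notin> J \<longrightarrow> n $ i = 0) \<and> set bs \<subseteq> roots1 J}"

lemma cone_nonneg:
  assumes "submodule N" "g \<in> cone J N"
  shows "g $ i \<ge> 0"
proof -
  obtain n bs where g: "g = n + sum_list bs" "n \<in> wts N" "set bs \<subseteq> roots1 J"
    using assms(2) by (auto simp: cone_def)
  have "sum_list bs $ i \<ge> 0"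
    using g(3)
  proof (induction bs)
    case (Cons b bs)
    then show ?case using roots1_nonneg[of b J i] by simp
  qed simp
  then show ?thesis using wts_nonneg[OF assms(1) g(2), of i] g(1) by simp
qed

text \<open>\<open>f i\<close> maps weight lam - g + \<open>\<alpha> i\<close> to lam - g, which is
  not a weight of V/N. So \<open>y\<close> lies in the nilpotent part but not in
  \<open>N\<close>.\<close>

lemma lowering_in_nil_part:
  assumes N: "submodule N" and g: "g \<notin> wts N" "g - axis i 1 \<in> wts N"
  obtains y where "y \<notin> N" "wt_vec lam (axis i 1 - g) y" "act (f i) y \<in> N"
    "N \<subset> nil_part (f i) N"
proof -
  obtain y where y: "y \<notin> N" "wt_vec lam (- (g - axis i 1)) y"
    using g(2) by (auto simp: wts_def)
  then have y': "wt_vec lam (axis i 1 - g) y" by simp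
  then have "wt_vec lam (- g) (act (f i) y)"
    using wt_vec_f[of lam _ y i] by fastforce
  then have fy: "act (f i) y \<in> N" using g(1) by (auto simp: wts_def)
  then have "(act (f i) ^^ 1) y \<in> N" by simp
  then have "y \<in> nil_part (f i) N" unfolding nil_part_def by blast
  then show ?thesis using that y(1) y' fy subset_nil_part by blast
qed

text \<open>Induction on the coefficient sum of \<open>g\<close>, for all \<open>N\<close> at once
  because the argument enlarges \<open>N\<close> to \<open>L\<close>. A smaller sum means a higher
  weight, so \<open>g\<close> is the maximal counterexample of the overview, with \<gamma> = lam - g
  and \<mu> = lam - n.\<close>

lemma cone_subset_wts:
  assumes J: "\<And>j. j \<in> J \<longleftrightarrow> lam (coroot j) \<in> \<nat>"
  shows "submodule N \<Longrightarrow> g \<in> cone J N \<Longrightarrow> g \<in> wts N"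
proof (induction "nat (\<Sum>i\<in>UNIV. g $ i)" arbitrary: g N rule: less_induct)
  case less
  \<comment> \<open>Elements of the cone have nonnegative coefficients, so the decrease by
    \<open>c\<close> survives the truncation in \<open>nat\<close>.\<close>
  have IH: "g' \<in> wts L" if "submodule L" "g' \<in> cone J L" "g' = g - axis i c" "c > 0" for g' L i c
  proof (rule less.hyps[OF _ that(1,2)])
    have "(\<Sum>k\<in>UNIV. g' $ k) = (\<Sum>k\<in>UNIV. g $ k) - c"
      by (simp add: that(3) sum_subtractf axis_def sum.delta)
    moreover have "(\<Sum>k\<in>UNIV. g' $ k) \<ge> 0"
      using cone_nonneg[OF that(1,2)] by (simp add: sum_nonneg)
    ultimately show "nat (\<Sum>k\<in>UNIV. g' $ k) < nat (\<Sum>k\<in>UNIV. g $ k)"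
      using that(4) by linarith
  qed
  show ?case
  proof (rule ccontr)
    assume gN: "g \<notin> wts N"
    obtain n bs where n: "g = n + sum_list bs" "n \<in> wts N" "\<And>i. i \<notin> J \<Longrightarrow> n $ i = 0"
      and bs: "set bs \<subseteq> roots1 J"
      using less.prems(2) by (auto simp: cone_def)
    obtain w where w: "w \<notin> N" "wt_vec lam (- n) w"
      using n(2) by (auto simp: wts_def)
    obtain L where L: "submodule L" "N \<subseteq> L" "w \<notin> L" "\<And>L'. submodule L' \<Longrightarrow> L \<subset> L' \<Longrightarrow> w \<in> L'"
      using maximal_submodule[OF less.prems(1) w(1)] by blast
    have gL: "g \<notin> wts L" using gN L(2) by (auto simp: wts_def)
    have nL: "n \<in> wts L" using w(2) L(3) by (auto simp: wts_def)
    have v: "v \<notin> L" using v_generates[OF L(1)] L(3) by auto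
    have coneI: "m + sum_list cs \<in> cone J L"
      if "m \<in> wts L" "\<And>i. i \<notin> J \<Longrightarrow> m $ i = 0" "set cs \<subseteq> roots1 J" for m cs
      using that unfolding cone_def by blast
    have nil: "w \<in> nil_part (f i) L" if "L \<subset> nil_part (f i) L" for i
      by (rule L(4)[OF submodule_nil_part[OF L(1) ad_f_nilpotent] that])
    have no_raise: "g - axis j 1 \<notin> cone J L" if j: "j \<in> J" for j
    proof
      interpret sl: sl2_triple scl br smul act "e j" "coroot j" "f j" L
        by (rule sl2_triple_simple[OF L(1)])
      have h: "act (coroot j) x = smul (lam (coroot j) + of_int (pairing j m)) x"
        if "wt_vec lam m x" for m x
        using that coroot_in_cartan[of j] by (simp add: wt_vec_def rt_coroot)
      assume "g - axis j 1 \<in> cone J L"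
      then have "g - axis j 1 \<in> wts L" by (rule IH[OF L(1) _ refl zero_less_one])
      then obtain y where y: "y \<notin> L" "wt_vec lam (axis j 1 - g) y" "act (f j) y \<in> L"
        "L \<subset> nil_part (f j) L"
        using lowering_in_nil_part[OF L(1) gL] by blast
      obtain k where "(act (f j) ^^ k) w \<in> L"
        using nil[OF y(4)] by (auto simp: nil_part_def)
      then obtain c x where c: "lam (coroot j) + of_int (pairing j (- n)) = of_int c"
        and x: "x \<notin> L" "wt_vec lam (- n - axis j c) x"
        using reflect_weight[OF L(1,3) w(2)] e_nilpotent[OF L(1)] by blast
      \<comment> \<open>The value of \<gamma> at the co-root: that of \<mu>, which is
        \<open>c\<close>, minus that of the roots in \<open>bs\<close>.\<close>
      define d where "d = c - pairing j (sum_list bs)"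
      have d: "lam (coroot j) - of_int (pairing j g) = of_int d"
        using c by (simp add: d_def n(1) algebra_simps)
      obtain k where "(act (e j) ^^ k) y \<in> L" using e_nilpotent[OF L(1)] by blast
      \<comment> \<open>In V/L the vector \<open>y\<close> is killed by \<open>f j\<close> and has
        co-root value d + 2, hence d + 2 \<le> 0.\<close>
      then have "- (lam (coroot j) + of_int (pairing j (axis j 1 - g))) \<in> \<nat>"
        by (rule sl.lowest_weight_nat[OF h[OF y(2)] y(3) _ y(1)])
      then obtain m where "- (lam (coroot j) + of_int (pairing j (axis j 1 - g))) = of_nat m"
        by (rule Nats_cases)
      moreover have "lam (coroot j) + of_int (pairing j (axis j 1 - g)) = of_int (d + 2)"
        using d by simp
      ultimately have "of_int (- (d + 2)) = (of_int (int m) :: complex)"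
        by (simp only: of_int_minus of_int_of_nat_eq)
      then have "- (d + 2) = int m" by (simp only: of_int_eq_iff)
      then have neg: "- d > 0" by simp
      \<comment> \<open>The reflection of \<gamma> is lam - (g + d \<open>\<alpha> j\<close>). It
        splits into the reflections of \<mu> and of the roots in \<open>bs\<close>, so it is again
        in the cone.\<close>
      have refl: "g + axis j d = n + axis j c + sum_list (map (\<lambda>b. b - axis j (pairing j b)) bs)"
      proof -
        have "sum_list (map (\<lambda>b. b - axis j (pairing j b)) bs) =
            sum_list bs - axis j (pairing j (sum_list bs))"
          by (induction bs) (simp_all add: vec_eq_iff axis_def)
        then show ?thesis by (simp add: n(1) d_def vec_eq_iff axis_def)
      qed
      have "g + axis j d \<in> cone J L"
        unfolding refl
      proof (rule coneI)
        show "n + axis j c \<in> wts L"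
          using x unfolding wts_def by (auto simp: algebra_simps)
        show "(n + axis j c) $ i = 0" if "i \<notin> J" for i
          using n(3)[OF that] j that by (auto simp: axis_def)
        show "set (map (\<lambda>b. b - axis j (pairing j b)) bs) \<subseteq> roots1 J"
          using bs roots1_reflect[OF _ j] by auto
      qed
      moreover have gd: "g + axis j d = g - axis j (- d)"
        by (simp add: vec_eq_iff axis_def)
      ultimately have "g + axis j d \<in> wts L"
        using IH[OF L(1) _ gd neg] by blast
      then obtain z where z: "z \<notin> L" "wt_vec lam (- (g + axis j d)) z"
        by (auto simp: wts_def)
      \<comment> \<open>The vector \<open>z\<close> of reflected weight has co-root value -d > 0.
        The power -d of \<open>f j\<close> does not kill it in V/L and leads back to \<gamma>, a
        contradiction.\<close>
      have "act (coroot j) z = smul (of_nat (nat (- d))) z"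
        using h[OF z(2)] d neg by (simp add: of_nat_nat algebra_simps)
      moreover obtain k where "(act (e j) ^^ k) z \<in> L" using e_nilpotent[OF L(1)] by blast
      ultimately have "(act (f j) ^^ nat (- d)) z \<notin> L"
        using sl.pow_f0_injective z(1) by blast
      moreover have "- (g + axis j d) - axis j (int (nat (- d))) = - g"
        using neg by (simp add: vec_eq_iff axis_def)
      then have "wt_vec lam (- g) ((act (f j) ^^ nat (- d)) z)"
        using wt_vec_pow_f[OF z(2), of j "nat (- d)"] by simp
      ultimately show False using gL by (auto simp: wts_def)
    qed
    \<comment> \<open>Otherwise a word of weight \<open>n\<close> starts with some
      \<open>f j\<close>, j in \<open>J\<close>. Deleting it leaves a weight of V/L supported on
      \<open>J\<close>, which puts \<open>g - axis j 1\<close> into the cone.\<close>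
    have "n = 0"
    proof -
      obtain ks where ks: "n = word_wt ks" "act_word act f ks v \<notin> L"
        using wt_word[OF L(1,3) w(2)] .
      show ?thesis
      proof (cases ks)
        case (Cons j ls)
        have "n $ j > 0" by (simp add: ks(1) Cons word_wt_nth)
        then have j: "j \<in> J" using n(3)[of j] by auto
        have "act_word act f ls v \<notin> L"
          using ks(2) submoduleD(5)[OF L(1)] Cons by auto
        then have "n - axis j 1 \<in> wts L"
          using wt_vec_word_f[OF wt_vec_v, of ls] unfolding wts_def by (auto simp: ks(1) Cons)
        then have "n - axis j 1 + sum_list bs \<in> cone J L"
          using n(3) j bs by (intro coneI) (auto simp: axis_def)
        then show ?thesis using no_raise[OF j] by (simp add: n(1) algebra_simps)
      qed (simp add: ks(1))
    qed
    show False
    proof (cases bs)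
      case Nil
      then show ?thesis using gL nL n(1) by simp
    next
      case (Cons b bs')
      have b: "b \<in> roots1 J" "set bs' \<subseteq> roots1 J" using bs Cons by auto
      from b(1) show ?thesis
      proof (cases rule: roots1_cases)
        case (2 j)
        then have "n + sum_list ((b - axis j 1) # bs') \<in> cone J L"
          using b n(3) nL by (intro coneI) auto
        then show ?thesis using no_raise[OF 2(1)] by (simp add: n(1) Cons algebra_simps)
      next
        case (1 i)
        have eq: "n + sum_list bs' = g - axis i 1"
          by (simp add: n(1) Cons 1)
        then have "g - axis i 1 \<in> cone J L"
          using coneI[OF nL n(3) b(2)] by simp
        then have "g - axis i 1 \<in> wts L" by (rule IH[OF L(1) _ refl zero_less_one])
        then have "L \<subset> nil_part (f i) L"
          using lowering_in_nil_part[OF L(1) gL] by blast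
        then have "w \<in> nil_part (f i) L" by (rule nil)
        \<comment> \<open>As \<open>n\<close> is zero, \<open>w\<close> is a nonzero multiple of
          \<open>v\<close>. So \<open>f i\<close> is nilpotent on the singular vector
          \<open>v\<close> in V/L, which forces a natural co-root value although i is outside
          \<open>J\<close>.\<close>
        moreover obtain c where c: "w = smul c v"
          using wt_vec_lam[of w] w(2) \<open>n = 0\<close> by auto
        moreover have "c \<noteq> 0" using c L(3) submoduleD(1)[OF L(1)] by auto
        ultimately have "v \<in> nil_part (f i) L"
          using submoduleD(4)[OF submodule_nil_part[OF L(1) ad_f_nilpotent], of w i "inverse c"]
          by simp
        then obtain k where "(act (f i) ^^ k) v \<in> L" by (auto simp: nil_part_def)
        moreover have "act (coroot i) v = smul (lam (coroot i)) v"
          by (rule v_weight[OF coroot_in_cartan])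
        ultimately have "lam (coroot i) \<in> \<nat>"
          using sl2_triple.singular_weight_nat[OF sl2_triple_simple[OF L(1)], of i v]
            v v_singular submoduleD(1)[OF L(1)] by simp
        then show False using J 1(1) by blast
      qed
    qed
  qed
qed

text \<open>The span of the products ending in words in the \<open>f j\<close>, j in
  \<open>J\<close>, on \<open>v\<close> contains \<open>v\<close> and is stable under every
  \<open>f k\<close>, so it is all of V.\<close>

lemma wts_subset_cone: "wts {0} \<subseteq> cone J {0}"
proof
  fix n assume "n \<in> wts {0}"
  then obtain x where x: "x \<noteq> 0" "wt_vec lam (- n) x" by (auto simp: wts_def)
  define B where "B z m \<longleftrightarrow> (\<exists>ks. set ks \<subseteq> J \<and> z = act_word act f ks v \<and> m = word_wt ks)" for z m
  have B: "B (act (f j) z) (m + axis j 1)" if z: "B z m" and j: "j \<in> J" for z m j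
  proof -
    obtain ks where "set ks \<subseteq> J" "z = act_word act f ks v" "m = word_wt ks"
      using z by (auto simp: B_def)
    then show ?thesis
      unfolding B_def using j by (intro exI[of _ "j # ks"]) (simp add: add.commute)
  qed
  have Bwt: "wt_vec lam (- m) z" if "B z m" for z m
    using that wt_vec_word_f[OF wt_vec_v] by (fastforce simp: B_def)
  have word: "act_word act f ks v \<in> M.span {z. \<exists>n. ht1_product J B z n}" for ks
  proof (induction ks)
    case Nil
    have "B v 0" unfolding B_def by (intro exI[of _ "[]"]) simp
    then have "v \<in> {z. \<exists>n. ht1_product J B z n}" using ht1_product.base[of B] by blast
    then show ?case by (simp add: M.span_base)
  next
    case (Cons k ks)
    then show ?case using span_ht1_product_stable[of B J, OF B] by simp
  qed
  have "range (\<lambda>ks. act_word act f ks v) \<subseteq> M.span {z. \<exists>n. ht1_product J B z n}"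
    using word by blast
  then have "M.span {z. \<exists>n. ht1_product J B z n} = UNIV"
    using M.span_minimal[OF _ M.subspace_span] span_words by blast
  then have span: "x \<in> M.span {z. \<exists>n. ht1_product J B z n}" by simp
  have wt: "\<exists>m. wt_vec lam m z" if "z \<in> {z. \<exists>n. ht1_product J B z n}" for z
    using that wt_vec_ht1_product[OF _ Bwt] by blast
  have "x \<notin> {0}" using x(1) by simp
  obtain z where "z \<in> {z. \<exists>n. ht1_product J B z n}" "wt_vec lam (- n) z" "z \<notin> {0}"
    by (rule wt_vec_span_elem[OF span x(2) wt M.subspace_single_0 \<open>x \<notin> {0}\<close>])
  then obtain m where z: "ht1_product J B z m" "wt_vec lam (- n) z" "z \<noteq> 0" by blast
  have "m = n"
    using wt_vec_unique[OF wt_vec_ht1_product[OF z(1) Bwt] z(2,3)] by simp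
  then obtain ks bs where ks: "set ks \<subseteq> J" "act_word act f ks v \<noteq> 0" "set bs \<subseteq> roots1 J"
    "n = word_wt ks + sum_list bs"
    using ht1_product_weight[OF z(1,3)] by (auto simp: B_def)
  have "word_wt ks \<in> wts {0}"
    using wt_vec_word_f[OF wt_vec_v, of ks] ks(2) by (auto simp: wts_def)
  moreover have "word_wt ks $ i = 0" if "i \<notin> J" for i
    using that ks(1) by (auto simp: word_wt_nth count_list_0_iff)
  ultimately show "n \<in> cone J {0}"
    unfolding cone_def using ks(3,4) by blast
qed

theorem wts_eq_cone:
  assumes "\<And>j. j \<in> J \<longleftrightarrow> lam (coroot j) \<in> \<nat>"
  shows "wts {0} = cone J {0}"
  using wts_subset_cone cone_subset_wts[OF assms submodule_zero] by blast

end

section \<open>Weights as functionals on the Cartan subalgebra\<close>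

lemma nat_spanI:
  fixes S :: "('g \<Rightarrow> complex) set"
  assumes "set xs \<subseteq> S"
  shows "(\<lambda>h. \<Sum>x\<leftarrow>xs. x h) \<in> nat_span S"
proof -
  have "(\<Sum>x\<leftarrow>ys. x h) = (\<Sum>s\<in>F. of_nat (count_list ys s) * s h)"
    if "finite F" "set ys \<subseteq> F" for h :: 'g and F and ys :: "('g \<Rightarrow> complex) list"
    using that(2)
  proof (induction ys)
    case (Cons y ys)
    have "(\<Sum>s\<in>F. of_nat (count_list (y # ys) s) * s h) =
        (\<Sum>s\<in>F. (if s = y then y h else 0) + of_nat (count_list ys s) * s h)"
      by (intro sum.cong) (auto simp: algebra_simps)
    then show ?case
      using Cons that(1) by (simp add: sum.distrib sum.delta)
  qed simp
  then have "(\<Sum>x\<leftarrow>xs. x h) = (\<Sum>s\<in>set xs. of_nat (count_list xs s) * s h)" for h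
    by simp
  then show ?thesis
    unfolding nat_span_def using assms by (auto intro!: exI[of _ "set xs"] exI[of _ "count_list xs"])
qed

text \<open>Lists with repetition replace natural coefficients, so that cones can be treated by
  induction on lists.\<close>

lemma nat_span_iff:
  "y \<in> nat_span S \<longleftrightarrow> (\<exists>xs. set xs \<subseteq> S \<and> y = (\<lambda>h. \<Sum>x\<leftarrow>xs. x h))"
proof
  assume "y \<in> nat_span S"
  then obtain F n where F: "finite F" "F \<subseteq> S" "y = (\<lambda>h. \<Sum>s\<in>F. of_nat (n s) * s h)"
    unfolding nat_span_def by blast
  have "\<exists>xs. set xs \<subseteq> F \<and> (\<forall>h. (\<Sum>s\<in>F. of_nat (n s) * s h) = (\<Sum>x\<leftarrow>xs. x h))"
    using F(1)
  proof induction
    case empty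
    then show ?case by (intro exI[of _ "[]"]) simp
  next
    case (insert s F)
    then obtain xs where xs: "set xs \<subseteq> F" "\<And>h. (\<Sum>s\<in>F. of_nat (n s) * s h) = (\<Sum>x\<leftarrow>xs. x h)"
      by blast
    have "sum_list (replicate k c) = of_nat k * c" for k and c :: complex
      by (simp add: sum_list_replicate)
    then show ?case
      using xs insert.hyps by (intro exI[of _ "replicate (n s) s @ xs"]) auto
  qed
  then obtain xs where "set xs \<subseteq> F" "\<And>h. (\<Sum>s\<in>F. of_nat (n s) * s h) = (\<Sum>x\<leftarrow>xs. x h)"
    by blast
  then show "\<exists>xs. set xs \<subseteq> S \<and> y = (\<lambda>h. \<Sum>x\<leftarrow>xs. x h)"
    using F(2,3) by (intro exI[of _ xs]) auto
qed (use nat_spanI in blast)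

section \<open>Roots and their cones in coordinates\<close>

context kac_moody_algebra
begin

interpretation adj: km_module scl br A H coroot \<alpha> e f scl br
  by (rule km_module_adjoint)

lemma rt_inject: "rt m = rt n \<longleftrightarrow> m = n"
proof
  assume "rt m = rt n"
  then have "rt (m - n) h = 0" for h by (simp add: fun_eq_iff)
  then have "m - n = 0" using rt_eq_0D by blast
  then show "m = n" by simp
qed simp

lemma rt_sum_list: "rt (sum_list bs) h = (\<Sum>b\<leftarrow>bs. rt b h)"
  by (induction bs) simp_all

lemma dual_space_eqI:
  assumes "\<mu> \<in> dual_space scl H" "\<nu> \<in> dual_space scl H" "\<And>h. h \<in> H \<Longrightarrow> \<mu> h = \<nu> h"
  shows "\<mu> = \<nu>"
proof
  fix h show "\<mu> h = \<nu> h"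
    using assms by (cases "h \<in> H") (simp_all add: dual_space_def)
qed

lemma dual_space_diff_rt:
  assumes "\<mu> \<in> dual_space scl H"
  shows "(\<lambda>h. \<mu> h - rt n h) \<in> dual_space scl H"
proof -
  have \<alpha>: "\<alpha> i (x + y) = \<alpha> i x + \<alpha> i y" "\<alpha> i (scl c x) = c * \<alpha> i x" if "x \<in> H" "y \<in> H" for i x y c
    using simple_root_in_dual[of i] that by (auto simp: dual_space_def)
  have "rt n (x + y) = rt n x + rt n y" "rt n (scl c x) = c * rt n x" if "x \<in> H" "y \<in> H" for x y c
    using \<alpha> that by (simp_all add: rt_def algebra_simps sum.distrib sum_distrib_left)
  moreover have "rt n x = 0" if "x \<notin> H" for x
    using simple_root_in_dual that by (simp add: rt_def dual_space_def)
  ultimately show ?thesis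
    using assms by (auto simp: dual_space_def algebra_simps)
qed

lemma zero_dual_space: "(\<lambda>_. 0) \<in> dual_space scl H"
  by (simp add: dual_space_def)

lemma rt_dual_space: "rt n \<in> dual_space scl H"
  using dual_space_diff_rt[OF zero_dual_space, of "- n"] by simp

lemma nat_span_rt: "nat_span (rt ` S) = rt ` {sum_list bs | bs. set bs \<subseteq> S}"
proof (intro set_eqI iffI)
  fix y assume "y \<in> nat_span (rt ` S)"
  then obtain xs where xs: "set xs \<subseteq> rt ` S" "y = (\<lambda>h. \<Sum>x\<leftarrow>xs. x h)"
    by (auto simp: nat_span_iff)
  from xs(1) have "xs \<in> map rt ` lists S"
    unfolding lists_image[symmetric] by auto
  then obtain bs where "set bs \<subseteq> S" "xs = map rt bs" by auto
  moreover from this have "y = rt (sum_list bs)"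
    by (simp add: xs(2) fun_eq_iff rt_sum_list o_def)
  ultimately show "y \<in> rt ` {sum_list bs | bs. set bs \<subseteq> S}" by blast
next
  fix y assume "y \<in> rt ` {sum_list bs | bs. set bs \<subseteq> S}"
  then obtain bs where bs: "set bs \<subseteq> S" "y = rt (sum_list bs)" by blast
  then have "set (map rt bs) \<subseteq> rt ` S" by auto
  then have "(\<lambda>h. \<Sum>x\<leftarrow>map rt bs. x h) \<in> nat_span (rt ` S)" by (rule nat_spanI)
  then show "y \<in> nat_span (rt ` S)"
    by (simp add: bs(2) rt_sum_list[abs_def] o_def)
qed

lemma simple_root_rt: "\<alpha> ` J = rt ` (\<lambda>i. axis i 1) ` J"
proof -
  have "\<alpha> i = rt (axis i 1)" for i by (simp add: fun_eq_iff)
  then show ?thesis by auto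
qed

lemma nat_span_simple: "nat_span (\<alpha> ` J) = rt ` {n. (\<forall>i. n $ i \<ge> 0) \<and> (\<forall>i. i \<notin> J \<longrightarrow> n $ i = 0)}"
proof -
  have "(\<exists>bs. n = sum_list bs \<and> set bs \<subseteq> (\<lambda>i. axis i 1) ` J) \<longleftrightarrow>
     (\<forall>i. n $ i \<ge> 0) \<and> (\<forall>i. i \<notin> J \<longrightarrow> n $ i = 0)" for n :: "int^'i"
  proof safe
    fix bs i assume "set bs \<subseteq> (\<lambda>i. axis i (1::int)) ` J"
    then show "sum_list bs $ i \<ge> 0" by (induction bs) (auto simp: axis_def)
  next
    fix bs i assume "set bs \<subseteq> (\<lambda>i. axis i (1::int)) ` J" "i \<notin> J"
    then show "sum_list bs $ i = 0" by (induction bs) (auto simp: axis_def)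
  next
    assume n: "\<forall>i. n $ i \<ge> 0" "\<forall>i. i \<notin> J \<longrightarrow> n $ i = 0"
    \<comment> \<open>A list containing each index of \<open>K\<close> as often as its coefficient
      prescribes; it is used for \<open>K\<close> equal to \<open>J\<close>.\<close>
    have "\<exists>ks. set ks \<subseteq> K \<and> (\<forall>i. int (count_list ks i) = (if i \<in> K then n $ i else 0))" if "finite K" for K
      using that
    proof induction
      case empty
      then show ?case by (intro exI[of _ "[]"]) simp
    next
      case (insert k K)
      then obtain ks where ks: "set ks \<subseteq> K" "\<And>i. int (count_list ks i) = (if i \<in> K then n $ i else 0)"
        by blast
      have "count_list (replicate m k) i = (if i = k then m else 0)" for m i
        by (induction m) auto
      then show ?case
        using ks insert.hyps n(1)
        by (intro exI[of _ "replicate (nat (n $ k)) k @ ks"]) auto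
    qed
    from this[of J] obtain ks where ks: "set ks \<subseteq> J"
      "\<And>i. int (count_list ks i) = (if i \<in> J then n $ i else 0)" by auto
    then have "n = word_wt ks"
      using n(2) by (simp add: vec_eq_iff word_wt_nth)
    then show "\<exists>bs. n = sum_list bs \<and> set bs \<subseteq> (\<lambda>i. axis i 1) ` J"
      using ks(1) by (intro exI[of _ "map (\<lambda>i. axis i 1) ks"]) (auto simp: word_wt_def)
  qed
  then show ?thesis
    unfolding simple_root_rt nat_span_rt by simp
qed

text \<open>\<open>roots\<close> admits any functional on \<open>H\<close>. That it comes from the
  root lattice follows by comparing a root vector with the weights of the triangular spanning
  set.\<close>

lemma roots_eq: "roots scl br H = rt ` root_set"
proof (intro set_eqI iffI)
  fix \<beta> assume "\<beta> \<in> rt ` root_set"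
  then obtain n x where n: "n \<noteq> 0" "x \<noteq> 0" "root_vec n x" "\<beta> = rt n"
    by (auto simp: root_set_def)
  moreover have "\<beta> \<noteq> (\<lambda>_. 0)"
    using n(1,4) rt_inject[of n 0] by (auto simp: fun_eq_iff)
  ultimately show "\<beta> \<in> roots scl br H"
    using rt_dual_space by (auto simp: roots_def root_vec_def)
next
  fix \<beta> assume "\<beta> \<in> roots scl br H"
  then obtain x where \<beta>: "\<beta> \<in> dual_space scl H" "\<beta> \<noteq> (\<lambda>_. 0)"
    and x: "x \<noteq> 0" "\<And>h. h \<in> H \<Longrightarrow> br h x = scl (\<beta> h) x"
    by (auto simp: roots_def)
  have T: "\<exists>n. root_vec n b" if "b \<in> H \<union> e_words \<union> f_words" for b
    using that root_vec_cartan root_vec_e_word root_vec_f_word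
    unfolding e_words_def f_words_def by blast
  obtain b where b: "b \<in> H \<union> e_words \<union> f_words" "\<And>h. h \<in> H \<Longrightarrow> br h b = scl (\<beta> h) b" "b \<notin> {0}"
  proof (rule adj.wt_vec_span_nonmember[of x "H \<union> e_words \<union> f_words" H \<beta> "{0}"])
    show "\<exists>\<kappa>. \<forall>h\<in>H. br h b = scl (\<kappa> h) b" if "b \<in> H \<union> e_words \<union> f_words" for b
      using T[OF that] unfolding root_vec_def by blast
  qed (use x in \<open>simp_all add: span_triangular subspace_single_0\<close>)
  obtain n where n: "root_vec n b" using T[OF b(1)] by blast
  have "\<beta> h = rt n h" if "h \<in> H" for h
  proof -
    have "scl (\<beta> h) b = scl (rt n h) b"
      using b(2)[OF that] n that unfolding root_vec_def by metis
    then show ?thesis using b(3) by simp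
  qed
  then have "\<beta> = rt n" by (rule dual_space_eqI[OF \<beta>(1) rt_dual_space])
  moreover from this have "n \<noteq> 0" using \<beta>(2) by (auto simp: fun_eq_iff)
  ultimately show "\<beta> \<in> rt ` root_set"
    using n b(3) by (auto simp: root_set_def)
qed

lemma ht_rt: "ht \<alpha> I (rt n) = of_int (\<Sum>i\<in>I. n $ i)"
proof -
  have "root_coeffs \<alpha> (rt n) = (\<lambda>i. of_int (n $ i))"
    using root_coeffs_eq[of "\<lambda>i. of_int (n $ i)"] by (simp add: rt_def[abs_def])
  then show ?thesis by (simp add: ht_def)
qed

lemma roots_ht1_eq: "roots_ht1 scl br H \<alpha> (- J) = rt ` roots1 J"
proof -
  have "ht \<alpha> (- J) (rt n) = 1 \<longleftrightarrow> ht_off J n = 1" for n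
    using of_int_eq_iff[of "\<Sum>i\<in>-J. n $ i" 1, where 'a = complex] by (simp add: ht_rt ht_off_def)
  then show ?thesis
    unfolding roots_ht1_def roots_eq roots1_def by auto
qed

lemma positive_roots_eq: "positive_roots scl br H \<alpha> = rt ` {n \<in> root_set. \<forall>i. n $ i \<ge> 0}"
  unfolding positive_roots_def roots_eq using nat_span_simple[of UNIV] rt_inject by auto

lemma int_span_simple: "rt n \<in> int_span (\<alpha> ` J) \<longleftrightarrow> (\<forall>i. i \<notin> J \<longrightarrow> n $ i = 0)"
proof
  assume "rt n \<in> int_span (\<alpha> ` J)"
  then obtain F m where F: "finite F" "F \<subseteq> \<alpha> ` J" "rt n = (\<lambda>h. \<Sum>s\<in>F. of_int (m s) * s h)"
    unfolding int_span_def by blast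
  have "\<exists>k. (\<forall>i. i \<notin> J \<longrightarrow> k $ i = 0) \<and> (\<lambda>h. \<Sum>s\<in>F. of_int (m s) * s h) = rt k"
    using F(1,2)
  proof induction
    case empty
    then show ?case by (intro exI[of _ 0]) (simp add: fun_eq_iff)
  next
    case (insert s F)
    then obtain k j where k: "\<forall>i. i \<notin> J \<longrightarrow> k $ i = 0" "(\<lambda>h. \<Sum>s\<in>F. of_int (m s) * s h) = rt k"
      and j: "s = \<alpha> j" "j \<in> J" by auto
    have "\<forall>i. i \<notin> J \<longrightarrow> (k + axis j (m s)) $ i = 0"
      using k(1) j(2) by (auto simp: axis_def)
    moreover have "(\<lambda>h. \<Sum>s\<in>insert s F. of_int (m s) * s h) = rt (k + axis j (m s))"
      using insert.hyps fun_cong[OF k(2)] by (simp add: fun_eq_iff j(1)[symmetric])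
    ultimately show ?case by blast
  qed
  then show "\<forall>i. i \<notin> J \<longrightarrow> n $ i = 0" using F(3) rt_inject by metis
next
  assume n: "\<forall>i. i \<notin> J \<longrightarrow> n $ i = 0"
  \<comment> \<open>Injectivity lets \<open>inv \<alpha>\<close> carry coefficients from indices to
    functionals.\<close>
  have inj: "inj \<alpha>"
  proof (rule injI)
    fix i j assume "\<alpha> i = \<alpha> j"
    then have "rt (axis i 1) = rt (axis j 1)" by (simp add: fun_eq_iff)
    then show "i = j" by (simp add: rt_inject axis_eq_axis)
  qed
  have "rt n h = (\<Sum>i\<in>J. of_int (n $ i) * \<alpha> i h)" for h
    unfolding rt_def using n by (intro sum.mono_neutral_right) auto
  also have "\<dots> h = (\<Sum>s\<in>\<alpha> ` J. of_int (n $ inv \<alpha> s) * s h)" for h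
    using inj by (subst sum.reindex) (auto simp: inj_on_def inv_f_f)
  finally have "rt n = (\<lambda>h. \<Sum>s\<in>\<alpha> ` J. of_int (n $ inv \<alpha> s) * s h)" by (rule ext)
  then show "rt n \<in> int_span (\<alpha> ` J)"
    unfolding int_span_def by (auto intro!: exI[of _ "\<alpha> ` J"] exI[of _ "\<lambda>s. n $ inv \<alpha> s"])
qed

text \<open>A positive root not supported on \<open>J\<close> has nonzero height off
  \<open>J\<close>, so \<open>root_sum_roots1\<close> splits it; conversely, roots of height one are
  positive and not supported on \<open>J\<close>.\<close>

lemma nat_span_positive_roots_off:
  "nat_span (positive_roots scl br H \<alpha> - positive_roots_on scl br H \<alpha> J) =
   nat_span (roots_ht1 scl br H \<alpha> (- J))"
proof -
  define P where "P = {n \<in> root_set. (\<forall>i. n $ i \<ge> 0) \<and> \<not> (\<forall>i. i \<notin> J \<longrightarrow> n $ i = 0)}"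
  have P: "positive_roots scl br H \<alpha> - positive_roots_on scl br H \<alpha> J = rt ` P"
    unfolding positive_roots_on_def roots_on_def positive_roots_eq roots_eq P_def
    using int_span_simple by auto
  have ht_off: "ht_off J n \<noteq> 0" if "n \<in> P" for n
  proof
    assume "ht_off J n = 0"
    then have "\<forall>i\<in>-J. n $ i = 0"
      unfolding ht_off_def using that by (subst (asm) sum_nonneg_eq_0_iff) (auto simp: P_def)
    then show False using that by (auto simp: P_def)
  qed
  have "\<exists>cs. sum_list bs = sum_list cs \<and> set cs \<subseteq> roots1 J" if "set bs \<subseteq> P" for bs
    using that
  proof (induction bs)
    case (Cons b bs)
    then obtain cs where cs: "sum_list bs = sum_list cs" "set cs \<subseteq> roots1 J" by auto
    obtain ds where "set ds \<subseteq> roots1 J" "b = sum_list ds"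
      using root_sum_roots1[of b J] Cons.prems ht_off[of b] by (auto simp: P_def)
    then show ?case using cs by (intro exI[of _ "ds @ cs"]) simp
  qed (auto intro: exI[of _ "[]"])
  moreover have "roots1 J \<subseteq> P"
  proof
    fix b assume b: "b \<in> roots1 J"
    have "\<not> (\<forall>i. i \<notin> J \<longrightarrow> b $ i = 0)"
    proof
      assume "\<forall>i. i \<notin> J \<longrightarrow> b $ i = 0"
      then have "ht_off J b = 0" by (simp add: ht_off_def)
      then show False using b by (simp add: roots1_def)
    qed
    then show "b \<in> P" using b roots1_nonneg[OF b] by (simp add: P_def roots1_def)
  qed
  ultimately have "{sum_list bs | bs. set bs \<subseteq> P} = {sum_list bs | bs. set bs \<subseteq> roots1 J}"
    by (smt (verit, best) Collect_cong subset_trans)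
  then show ?thesis unfolding P roots_ht1_eq nat_span_rt by simp
qed

end

section \<open>Weights of V in coordinates\<close>

context hw_module
begin

text \<open>As for roots, an arbitrary weight functional is identified on \<open>H\<close> with the
  weight of a word applied to \<open>v\<close>.\<close>

lemma weights_eq:
  assumes "lam \<in> dual_space scl H"
  shows "weights scl H smul act = (\<lambda>n h. lam h - rt n h) ` wts {0}"
proof (intro set_eqI iffI)
  fix \<mu> assume "\<mu> \<in> (\<lambda>n h. lam h - rt n h) ` wts {0}"
  then show "\<mu> \<in> weights scl H smul act"
    using dual_space_diff_rt[OF assms] by (auto simp: weights_def wts_def wt_vec_def)
next
  fix \<mu> assume "\<mu> \<in> weights scl H smul act"
  then obtain x where \<mu>: "\<mu> \<in> dual_space scl H"
    and x: "x \<noteq> 0" "\<And>h. h \<in> H \<Longrightarrow> act h x = smul (\<mu> h) x"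
    by (auto simp: weights_def)
  have wt: "wt_vec lam (- word_wt ks) (act_word act f ks v)" for ks
    using wt_vec_word_f[OF wt_vec_v, of ks] by simp
  obtain b where b: "b \<in> range (\<lambda>ks. act_word act f ks v)" "\<And>h. h \<in> H \<Longrightarrow> act h b = smul (\<mu> h) b" "b \<notin> {0}"
  proof (rule wt_vec_span_nonmember[of x "range (\<lambda>ks. act_word act f ks v)" H \<mu> "{0}"])
    show "\<exists>\<kappa>. \<forall>h\<in>H. act h b = smul (\<kappa> h) b" if b: "b \<in> range (\<lambda>ks. act_word act f ks v)" for b
    proof -
      obtain ks where "b = act_word act f ks v" using b by blast
      then show ?thesis
        using wt[of ks] unfolding wt_vec_def
        by (intro exI[of _ "\<lambda>h. lam h + rt (- word_wt ks) h"]) simp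
    qed
  qed (use x in \<open>simp_all add: span_words M.subspace_single_0\<close>)
  then obtain ks where ks: "b = act_word act f ks v" by blast
  have "\<mu> h = lam h - rt (word_wt ks) h" if "h \<in> H" for h
  proof -
    have "act h b = smul (lam h - rt (word_wt ks) h) b"
      using wt[of ks] that by (simp add: wt_vec_def ks)
    then have "smul (\<mu> h) b = smul (lam h - rt (word_wt ks) h) b"
      by (simp only: b(2)[OF that])
    then show ?thesis using b(3) by simp
  qed
  then have "\<mu> = (\<lambda>h. lam h - rt (word_wt ks) h)"
    by (rule dual_space_eqI[OF \<mu> dual_space_diff_rt[OF assms]])
  moreover have "word_wt ks \<in> wts {0}"
    using b(3) wt[of ks] by (auto simp: wts_def ks)
  ultimately show "\<mu> \<in> (\<lambda>n h. lam h - rt n h) ` wts {0}" by blast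
qed

lemma weights_on_eq:
  assumes "lam \<in> dual_space scl H"
  shows "weights_on scl H \<alpha> smul act lam J =
    (\<lambda>n h. lam h - rt n h) ` {n \<in> wts {0}. \<forall>i. i \<notin> J \<longrightarrow> n $ i = 0}"
proof -
  have inj: "(\<lambda>h. lam h - rt m h) = (\<lambda>h. lam h - rt n h) \<longleftrightarrow> m = n" for m n
    using rt_inject[of m n] by (simp add: fun_eq_iff)
  have "{lam} \<ominus>\<^sub>s nat_span (\<alpha> ` J) = (\<lambda>n h. lam h - rt n h) `
     {n. (\<forall>i. n $ i \<ge> 0) \<and> (\<forall>i. i \<notin> J \<longrightarrow> n $ i = 0)}"
    unfolding nat_span_simple set_diff_def by auto
  then show ?thesis
    unfolding weights_on_def weights_eq[OF assms]
    using inj wts_nonneg[OF submodule_zero] by auto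
qed

lemma weights_formula:
  assumes "lam \<in> dual_space scl H" and J: "J = integrable_nodes coroot lam"
  shows "weights scl H smul act =
    weights_on scl H \<alpha> smul act lam J \<ominus>\<^sub>s nat_span (roots_ht1 scl br H \<alpha> (- J))"
proof -
  \<comment> \<open>The choice of \<open>J\<close> as \<open>integrable_nodes\<close> is exactly the
    hypothesis of \<open>wts_eq_cone\<close>.\<close>
  have cone: "wts {0} = cone J {0}"
    by (rule wts_eq_cone) (simp add: J integrable_nodes_def)
  show ?thesis
    unfolding weights_on_eq[OF assms(1)] roots_ht1_eq nat_span_rt set_diff_def
    unfolding weights_eq[OF assms(1)]
  proof (intro set_eqI iffI)
    fix \<mu> assume "\<mu> \<in> (\<lambda>n h. lam h - rt n h) ` wts {0}"
    then obtain k where k: "k \<in> cone J {0}" "\<mu> = (\<lambda>h. lam h - rt k h)"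
      using cone by blast
    then obtain n bs where "n \<in> wts {0}" "\<forall>i. i \<notin> J \<longrightarrow> n $ i = 0" "set bs \<subseteq> roots1 J"
      "k = n + sum_list bs"
      unfolding cone_def by blast
    moreover from this have "\<mu> = (\<lambda>h. (lam h - rt n h) - rt (sum_list bs) h)"
      by (simp add: k(2) fun_eq_iff)
    ultimately show "\<mu> \<in> {\<lambda>h. a h - b h |a b.
       a \<in> (\<lambda>n h. lam h - rt n h) ` {n \<in> wts {0}. \<forall>i. i \<notin> J \<longrightarrow> n $ i = 0} \<and>
       b \<in> rt ` {sum_list bs |bs. set bs \<subseteq> roots1 J}}"
      by (intro CollectI exI[of _ "\<lambda>h. lam h - rt n h"] exI[of _ "rt (sum_list bs)"]) blast
  next
    fix \<mu> assume "\<mu> \<in> {\<lambda>h. a h - b h |a b.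
       a \<in> (\<lambda>n h. lam h - rt n h) ` {n \<in> wts {0}. \<forall>i. i \<notin> J \<longrightarrow> n $ i = 0} \<and>
       b \<in> rt ` {sum_list bs |bs. set bs \<subseteq> roots1 J}}"
    then obtain n bs where n: "n \<in> wts {0}" "\<forall>i. i \<notin> J \<longrightarrow> n $ i = 0" "set bs \<subseteq> roots1 J"
      "\<mu> = (\<lambda>h. (lam h - rt n h) - rt (sum_list bs) h)" by blast
    then have "n + sum_list bs \<in> wts {0}"
      using cone unfolding cone_def by blast
    moreover have "\<mu> = (\<lambda>h. lam h - rt (n + sum_list bs) h)"
      using n(4) by (simp add: fun_eq_iff)
    ultimately show "\<mu> \<in> (\<lambda>n h. lam h - rt n h) ` wts {0}" by blast
  qed
qed

end

theorem theorem3p3: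
  fixes scl :: "complex \<Rightarrow> 'g::ab_group_add \<Rightarrow> 'g"
    and br :: "'g \<Rightarrow> 'g \<Rightarrow> 'g"
    and A :: "int^'i^'i"
    and H :: "'g set"
    and coroot :: "'i \<Rightarrow> 'g"
    and \<alpha> :: "'i \<Rightarrow> 'g \<Rightarrow> complex"
    and e f :: "'i \<Rightarrow> 'g"
    and smul :: "complex \<Rightarrow> 'v::ab_group_add \<Rightarrow> 'v"
    and act :: "'g \<Rightarrow> 'v \<Rightarrow> 'v"
    and lam :: "'g \<Rightarrow> complex"
  assumes "kac_moody_algebra scl br A H coroot \<alpha> e f"
    and "finite_or_affine_type scl br A"
    and "lam \<in> dual_space scl H"
    and "highest_weight_module scl br H e smul act lam"
  shows "weights scl H smul act =
           weights_on scl H \<alpha> smul act lam (integrable_nodes coroot lam) \<ominus>\<^sub>s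
             nat_span (roots_ht1 scl br H \<alpha> (- integrable_nodes coroot lam)) \<and>
         weights_on scl H \<alpha> smul act lam (integrable_nodes coroot lam) \<ominus>\<^sub>s
           nat_span (roots_ht1 scl br H \<alpha> (- integrable_nodes coroot lam)) =
         weights_on scl H \<alpha> smul act lam (integrable_nodes coroot lam) \<ominus>\<^sub>s
           nat_span (positive_roots scl br H \<alpha> -
             positive_roots_on scl br H \<alpha> (integrable_nodes coroot lam))"
proof -
  interpret kac_moody_algebra scl br A H coroot \<alpha> e f by fact
  interpret lie_module scl br smul act
    using assms(4) by (simp add: highest_weight_module_def)
  obtain v where "v \<noteq> 0" "\<forall>h\<in>H. act h v = smul (lam h) v" "\<forall>i. act (e i) v = 0"
    "\<forall>U. submodule U \<and> v \<in> U \<longrightarrow> U = UNIV"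
    using assms(4) unfolding highest_weight_module_def by blast
  then interpret hw_module scl br A H coroot \<alpha> e f smul act lam v
    by unfold_locales auto
  show ?thesis
    using weights_formula[OF assms(3) refl] nat_span_positive_roots_off by simp
qed

end
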